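(* Let $K\neq0$ and let $A,P,B,Q$ be points of an $\Re_K$ domain $(\mathcal M,\rho)$ with $A\neq P$, $B\neq Q$, and, if $K>0$, $\operatorname{diam}\{A,P,B,Q\}\le\pi/(2\sqrt K)$. Then $|\operatorname{cosq}_K(\overrightarrow{AP},\overrightarrow{BQ})|\le1$.
   Context: Let $\kappa=\sqrt{|K|}$. For $A\neq P$, $B\neq Q$ put $x=\rho(A,P)$, $y=\rho(B,Q)$, $a=\rho(A,B)$, $b=\rho(P,Q)$, $d=\rho(P,B)$, $f=\rho(A,Q)$; for $K>0$ $$\operatorname{cosq}_K(\overrightarrow{AP},\overrightarrow{BQ})=\frac{\cos\kappa b+\cos\kappa x\cos\kappa y}{\sin\kappa x\sin\kappa y}-\frac{(\cos\kappa x+\cos\kappa d)(\cos\kappa y+\cos\kappa f)}{(1+\cos\kappa a)\sin\kappa x\sin\kappa y},$$ and for $K<0$ $$\operatorname{cosq}_K(\overrightarrow{AP},\overrightarrow{BQ})=\frac{(\cosh\kappa x+\cosh\kappa d)(\cosh\kappa y+\cosh\kappa f)}{(1+\cosh\kappa a)\sinh\kappa x\sinh\kappa y}-\frac{\cosh\kappa b+\cosh\kappa x\cosh\kappa y}{\sinh\kappa x\sinh\kappa y}.$$ $\Re_K$ domain: a metric space in which any two points are joined by a shortest (curve of length equal to their distance), in which (if $K>0$) every geodesic triangle has perimeter $<2\pi/\sqrt K$, and in which every geodesic triangle $ABC$ has sum of upper angles between its sides at its three vertices at most $\angle_KBAC+\angle_KABC+\angle_KACB$, where $\angle_K$ denotes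 the angle of the comparison triangle with the same side lengths in the model plane $\mathbb S_K$ (open hemisphere of radius $1/\sqrt K$ for $K>0$, hyperbolic plane of curvature $K$ for $K<0$), and the upper angle between shortests $\mathcal L,\mathcal N$ from $O$ is $\limsup\angle_0XOY$ as $X\to O$ in $\mathcal L\setminus\{O\}$, $Y\to O$ in $\mathcal N\setminus\{O\}$ ($\angle_0$ = Euclidean comparison angle). *)

theory Defs
  imports "HOL-Analysis.Analysis"
begin

definition curve_length :: "(real \<Rightarrow> 'a::metric_space) \<Rightarrow> real \<Rightarrow> real \<Rightarrow> ereal" where
  "curve_length \<gamma> a b =
     (SUP ts \<in> {ts. sorted ts \<and> set ts \<subseteq> {a..b}}.
        ereal (\<Sum>i < length ts - 1. dist (\<gamma> (ts ! i)) (\<gamma> (ts ! Suc i))))"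

definition shortest :: "'a::metric_space \<Rightarrow> 'a \<Rightarrow> 'a set \<Rightarrow> bool" where
  "shortest p q L \<longleftrightarrow> (\<exists>\<gamma>. continuous_on {0..1} \<gamma> \<and> \<gamma> 0 = p \<and> \<gamma> 1 = q \<and>
      curve_length \<gamma> 0 1 = ereal (dist p q) \<and> L = \<gamma> ` {0..1})"

text \<open>Angle at the vertex opposite to side \<open>c\<close> of the comparison triangle with
  side lengths \<open>a, b, c\<close> in the model plane \<open>\<bbbS>_K\<close>.\<close>
definition comp_angle :: "real \<Rightarrow> real \<Rightarrow> real \<Rightarrow> real \<Rightarrow> real" where
  "comp_angle K a b c =
    (let \<kappa> = sqrt \<bar>K\<bar> in
     if K = 0 then arccos ((a\<^sup>2 + b\<^sup>2 - c\<^sup>2) / (2 * a * b))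
     else if K > 0 then arccos ((cos (\<kappa> * c) - cos (\<kappa> * a) * cos (\<kappa> * b)) / (sin (\<kappa> * a) * sin (\<kappa> * b)))
     else arccos ((cosh (\<kappa> * a) * cosh (\<kappa> * b) - cosh (\<kappa> * c)) / (sinh (\<kappa> * a) * sinh (\<kappa> * b))))"

definition angleK :: "real \<Rightarrow> 'a::metric_space \<Rightarrow> 'a \<Rightarrow> 'a \<Rightarrow> real" where
  "angleK K B A C = comp_angle K (dist A B) (dist A C) (dist B C)"

definition upper_angle :: "'a::metric_space \<Rightarrow> 'a set \<Rightarrow> 'a set \<Rightarrow> ereal" where
  "upper_angle V L N =
     Limsup (at (V, V) within ((L - {V}) \<times> (N - {V})))
            (\<lambda>(X, Y). ereal (angleK 0 X V Y))"

definition RK_domain :: "real \<Rightarrow> 'a::metric_space itself \<Rightarrow> bool" where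
  "RK_domain K _ \<longleftrightarrow>
     (\<forall>p q::'a. \<exists>L. shortest p q L) \<and>
     (K > 0 \<longrightarrow> (\<forall>A B C::'a. dist A B + dist B C + dist C A < 2 * pi / sqrt K)) \<and>
     (\<forall>A B C::'a. \<forall>LAB LBC LCA. A \<noteq> B \<and> B \<noteq> C \<and> A \<noteq> C \<and>
        shortest A B LAB \<and> shortest B C LBC \<and> shortest C A LCA \<longrightarrow>
        upper_angle A LAB LCA + upper_angle B LAB LBC + upper_angle C LCA LBC
          \<le> ereal (angleK K B A C + angleK K A B C + angleK K A C B))"

definition cosq :: "real \<Rightarrow> 'a::metric_space \<Rightarrow> 'a \<Rightarrow> 'a \<Rightarrow> 'a \<Rightarrow> real" where
  "cosq K A P B Q =
    (let \<kappa> = sqrt \<bar>K\<bar>; x = dist A P; y = dist B Q; a = dist A B; b = dist P Q;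
         d = dist P B; f = dist A Q in
     if K > 0 then
       (cos (\<kappa>*b) + cos (\<kappa>*x) * cos (\<kappa>*y)) / (sin (\<kappa>*x) * sin (\<kappa>*y))
       - (cos (\<kappa>*x) + cos (\<kappa>*d)) * (cos (\<kappa>*y) + cos (\<kappa>*f))
           / ((1 + cos (\<kappa>*a)) * sin (\<kappa>*x) * sin (\<kappa>*y))
     else
       (cosh (\<kappa>*x) + cosh (\<kappa>*d)) * (cosh (\<kappa>*y) + cosh (\<kappa>*f))
           / ((1 + cosh (\<kappa>*a)) * sinh (\<kappa>*x) * sinh (\<kappa>*y))
       - (cosh (\<kappa>*b) + cosh (\<kappa>*x) * cosh (\<kappa>*y)) / (sinh (\<kappa>*x) * sinh (\<kappa>*y)))"

end

(* Two things are shown. First, the angle sum condition implies the comparison inequality for the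
   distance from a point to a point on a side of a triangle. The key is that an upper angle never
   exceeds its comparison angle: at a (penalised) minimum of the comparison angle over the points of
   two sides, first variation makes the other two upper angles at least their comparison angles.

   Second, in the model space cosq is the inner product of one unit vector with the parallel
   translate of the other, so there it is bounded by Cauchy-Schwarz. For cosq >= -1 one compares
   with the model quadrilateral A P B Q glued along AB, for cosq <= 1 with A B Q P glued along BP.
   If it is convex, the remaining diagonal can only be longer in the model space, since the segment
   joining its ends crosses the common side. If it is not convex at a vertex, the triangle inequality
   through that vertex bounds the diagonal, and the case reduces to a straight angle there. *)
theory Submission
  imports Defs
begin

section \<open>Trigonometry of the model space\<close>

text \<open>The infimum of the comparison angle over two sides may only be approached as a point
  tends to the vertex; this is why a penalty is needed. A logarithm has slope 1/x, and the first
  variation multiplies this slope by sn x, so the error is epsilon times a bound for sn x / x,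
  wherever on the sides the minimum lies. The two gluings are dictated by signs. For either sign of
  K, cosq grows when PQ shrinks and falls when AQ shrinks, the other distances being fixed.
  Comparison shortens a diagonal, so a lower bound survives when that diagonal is PQ and an upper
  bound when it is AQ. The diameter bound makes every value of cs nonnegative, which keeps the
  coefficients in these monotonicity arguments nonnegative. Points of the model space are treated as
  unit vectors of a three-dimensional space with a form for which cs of the distance is the inner
  product. Terms such as cs * cs + K * (...) are inner products written in coordinates at a
  vertex.\<close>

definition cs :: "real \<Rightarrow> real \<Rightarrow> real" where
  "cs K t = (if K > 0 then cos (sqrt \<bar>K\<bar> * t) else cosh (sqrt \<bar>K\<bar> * t))"

text \<open>With this scaling cs' = -K sn, sn' = cs and cs^2 + K sn^2 = 1 hold for both signs of
  \<open>K\<close>. Inequalities between values of \<open>cs\<close> carry a factor \<open>K\<close>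
  throughout, because \<open>K * cs K\<close> is the function that decreases for either
  sign.\<close>

definition sn :: "real \<Rightarrow> real \<Rightarrow> real" where
  "sn K t = (if K > 0 then sin (sqrt \<bar>K\<bar> * t) / sqrt \<bar>K\<bar> else sinh (sqrt \<bar>K\<bar> * t) / sqrt \<bar>K\<bar>)"

definition below_diam :: "real \<Rightarrow> real \<Rightarrow> bool" where
  "below_diam K t \<longleftrightarrow> (K > 0 \<longrightarrow> t \<le> pi / sqrt K)"

lemma cs_zero [simp]: "cs K 0 = 1" and sn_zero [simp]: "sn K 0 = 0"
  by (simp_all add: cs_def sn_def)

lemma cs_minus [simp]: "cs K (- t) = cs K t" and sn_minus [simp]: "sn K (- t) = - sn K t"
  by (simp_all add: cs_def sn_def)

lemma cs_sq_add: "K \<noteq> 0 \<Longrightarrow> (cs K t)\<^sup>2 + K * (sn K t)\<^sup>2 = 1"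
  by (simp add: cs_def sn_def power_divide cosh_square_eq)

lemma cs_add: "K \<noteq> 0 \<Longrightarrow> cs K (s + t) = cs K s * cs K t - K * (sn K s * sn K t)"
  by (simp add: cs_def sn_def distrib_left cos_add cosh_add)

lemma sn_add: "sn K (s + t) = sn K s * cs K t + cs K s * sn K t"
  by (simp add: cs_def sn_def distrib_left sin_add sinh_add add_divide_distrib)

lemma cs_diff: "K \<noteq> 0 \<Longrightarrow> cs K (s - t) = cs K s * cs K t + K * (sn K s * sn K t)"
  using cs_add[of K s "- t"] by simp

lemma sn_diff: "sn K (s - t) = sn K s * cs K t - cs K s * sn K t"
  using sn_add[of K s "- t"] by simp

lemma sn_pos:
  assumes "K \<noteq> 0" "0 < t" "K > 0 \<Longrightarrow> t < pi / sqrt K"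
  shows "0 < sn K t"
proof (cases "K > 0")
  case True
  then have "sqrt K * t < pi" using assms by (simp add: field_simps)
  with True assms show ?thesis by (simp add: sn_def sin_gt_zero)
next
  case False
  with assms show ?thesis by (simp add: sn_def)
qed

lemma sn_nonneg:
  assumes "K \<noteq> 0" "0 \<le> t" "below_diam K t"
  shows "0 \<le> sn K t"
proof (cases "K > 0")
  case True
  then have "sqrt K * t \<le> pi" using assms by (simp add: field_simps below_diam_def)
  with True assms show ?thesis by (simp add: sn_def sin_ge_zero)
next
  case False
  with assms show ?thesis by (simp add: sn_def)
qed

lemma cs_strict_antimono:
  assumes "K \<noteq> 0" "0 \<le> s" "s < t" "below_diam K t"
  shows "K * cs K t < K * cs K s"
proof (cases "K > 0")
  case True
  then have "sqrt K * t \<le> pi" using assms by (simp add: field_simps below_diam_def)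
  moreover have "sqrt K * s < sqrt K * t" using True assms by simp
  ultimately show ?thesis using True assms by (simp add: cs_def cos_monotone_0_pi)
next
  case False
  then have "sqrt (- K) * s < sqrt (- K) * t" using assms by simp
  with False assms show ?thesis by (simp add: cs_def cosh_real_nonneg_less_iff)
qed

lemma cs_antimono:
  assumes "K \<noteq> 0" "0 \<le> s" "s \<le> t" "below_diam K t"
  shows "K * cs K t \<le> K * cs K s"
  using cs_strict_antimono[of K s t] assms by (cases "s = t") auto

lemma has_field_derivative_cs:
  assumes "K \<noteq> 0" shows "(cs K has_real_derivative - K * sn K t) (at t)"
proof (cases "K > 0")
  case True
  have "((\<lambda>t. cos (sqrt K * t)) has_real_derivative - K * sn K t) (at t)"
    using True by (auto intro!: derivative_eq_intros simp: sn_def field_simps)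
  then show ?thesis using True by (simp add: cs_def[abs_def])
next
  case False
  then have "K < 0" using assms by simp
  then have sq: "sqrt (- K) * (sqrt (- K) * x) = - (K * x)" for x
    by (simp flip: mult.assoc)
  have "((\<lambda>t. cosh (sqrt (- K) * t)) has_real_derivative - K * sn K t) (at t)"
    using \<open>K < 0\<close> by (auto intro!: derivative_eq_intros simp: sn_def field_simps sq)
  then show ?thesis using \<open>K < 0\<close> by (simp add: cs_def[abs_def])
qed

lemma has_field_derivative_sn:
  assumes "K \<noteq> 0" shows "(sn K has_real_derivative cs K t) (at t)"
proof -
  have "((\<lambda>t. sin (k * t) / k) has_real_derivative cos (k * t)) (at t)"
    and "((\<lambda>t. sinh (k * t) / k) has_real_derivative cosh (k * t)) (at t)" if "k \<noteq> 0" for k :: real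
    using that by (auto intro!: derivative_eq_intros)
  from this[of "sqrt \<bar>K\<bar>"] show ?thesis
    using assms by (cases "K > 0") (simp_all add: sn_def[abs_def] cs_def[abs_def])
qed

lemma continuous_on_cs [continuous_intros]:
  assumes "K \<noteq> 0" "continuous_on S f" shows "continuous_on S (\<lambda>x. cs K (f x))"
proof (rule continuous_on_compose2[OF _ assms(2)])
  show "continuous_on UNIV (cs K)"
    using has_field_derivative_cs[OF assms(1)] by (intro DERIV_continuous_on)
qed auto

lemma continuous_on_sn [continuous_intros]:
  assumes "K \<noteq> 0" "continuous_on S f" shows "continuous_on S (\<lambda>x. sn K (f x))"
proof (rule continuous_on_compose2[OF _ assms(2)])
  show "continuous_on UNIV (sn K)"
    using has_field_derivative_sn[OF assms(1)] by (intro DERIV_continuous_on)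
qed auto

lemma comp_angle_eq:
  assumes "K \<noteq> 0"
  shows "comp_angle K a b c = arccos ((cs K c - cs K a * cs K b) / (K * (sn K a * sn K b)))"
proof (cases "K > 0")
  case True
  then show ?thesis by (simp add: comp_angle_def cs_def sn_def Let_def)
next
  case False
  then have "K < 0" using assms by simp
  then have "K * (sn K a * sn K b) = - (sinh (sqrt \<bar>K\<bar> * a) * sinh (sqrt \<bar>K\<bar> * b))"
    by (simp add: sn_def)
  then show ?thesis using False assms by (simp add: comp_angle_def cs_def Let_def minus_divide_left)
qed

text \<open>By the addition formulas the claim places \<open>cs K c\<close> between
  \<open>cs K (a - b)\<close> and \<open>cs K (a + b)\<close>, which is the triangle inequality read
  through the monotonicity of \<open>K * cs K\<close>. It guarantees that \<open>arccos\<close> in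
  the comparison angle is inverted by the cosine.\<close>

lemma comp_angle_bound:
  assumes "K \<noteq> 0" "0 < a" "0 < b" "0 \<le> c" "a \<le> b + c" "b \<le> a + c" "c \<le> a + b"
    and "K > 0 \<Longrightarrow> a < pi / sqrt K \<and> b < pi / sqrt K \<and> a + b + c < 2 * pi / sqrt K"
  shows "\<bar>(cs K c - cs K a * cs K b) / (K * (sn K a * sn K b))\<bar> \<le> 1"
proof -
  let ?p = "sn K a * sn K b"
  have p: "0 < ?p" using assms by (intro mult_pos_pos sn_pos) auto
  have c: "below_diam K c"
    unfolding below_diam_def
  proof
    assume "K > 0"
    with assms(8) have "a + b + c < 2 * (pi / sqrt K)" by simp
    with assms(7) show "c \<le> pi / sqrt K" by linarith
  qed
  have "K * cs K c \<le> K * cs K \<bar>a - b\<bar>"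
    using assms c by (intro cs_antimono) auto
  also have "cs K \<bar>a - b\<bar> = cs K (a - b)" by (simp add: abs_if flip: cs_minus[of K "a - b"])
  finally have u: "K * (cs K c - cs K a * cs K b) \<le> K * (K * ?p)"
    using assms by (simp add: cs_diff algebra_simps)
  have "K * cs K (a + b) \<le> K * cs K c"
  proof (cases "below_diam K (a + b)")
    case True
    then show ?thesis using assms by (intro cs_antimono) auto
  next
    \<comment> \<open>Past the half circle monotonicity fails. The complementary arc has the same
      cosine, and the perimeter bound says that it is at least \<open>c\<close>.\<close>
    case False
    then have K: "K > 0" by (auto simp: below_diam_def)
    have "cs K (a + b) = cs K (2 * pi / sqrt K - (a + b))"
      using K cos_2pi_minus[of "sqrt K * (a + b)"] by (simp add: cs_def right_diff_distrib)
    moreover have "K * cs K (2 * pi / sqrt K - (a + b)) \<le> K * cs K c"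
    proof (rule cs_antimono)
      have *: "2 * pi / sqrt K = 2 * (pi / sqrt K)" by simp
      show "below_diam K (2 * pi / sqrt K - (a + b))"
        using False K unfolding * by (auto simp: below_diam_def)
      show "c \<le> 2 * pi / sqrt K - (a + b)" using assms(8)[OF K] by linarith
    qed (use assms in auto)
    ultimately show ?thesis by simp
  qed
  then have l: "K * - (K * ?p) \<le> K * (cs K c - cs K a * cs K b)"
    using assms by (simp add: cs_add algebra_simps)
  let ?q = "(cs K c - cs K a * cs K b) / (K * ?p)"
  have "(K * K) * ?p * ?q = K * (cs K c - cs K a * cs K b)"
    using less_imp_neq[OF p] assms(1) by auto
  then have "(K * K) * ?p * ?q \<le> (K * K) * ?p * 1" "(K * K) * ?p * (-1) \<le> (K * K) * ?p * ?q"
    using u l by auto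
  moreover have "0 < (K * K) * ?p" using p assms by (metis mult_pos_pos not_real_square_gt_zero)
  ultimately have "?q \<le> 1" "-1 \<le> ?q" by (simp_all only: mult_le_cancel_left_pos)
  then show ?thesis by linarith
qed

section \<open>Shortest paths and upper angles\<close>

definition unit_speed :: "(real \<Rightarrow> 'a::metric_space) \<Rightarrow> real \<Rightarrow> bool" where
  "unit_speed \<sigma> l \<longleftrightarrow> (\<forall>s\<in>{0..l}. \<forall>t\<in>{0..l}. dist (\<sigma> s) (\<sigma> t) = \<bar>s - t\<bar>)"

lemma unit_speedD: "unit_speed \<sigma> l \<Longrightarrow> 0 \<le> s \<Longrightarrow> s \<le> l \<Longrightarrow> 0 \<le> t \<Longrightarrow> t \<le> l \<Longrightarrow> dist (\<sigma> s) (\<sigma> t) = \<bar>s - t\<bar>"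
  by (simp add: unit_speed_def)

lemma unit_speed_continuous_on:
  assumes "unit_speed \<sigma> l" shows "continuous_on {0..l} \<sigma>"
  unfolding continuous_on_iff
proof (intro ballI allI impI)
  fix x e :: real assume "x \<in> {0..l}" "0 < e"
  then show "\<exists>d>0. \<forall>x'\<in>{0..l}. dist x' x < d \<longrightarrow> dist (\<sigma> x') (\<sigma> x) < e"
    using assms by (intro exI[of _ e]) (auto simp: unit_speed_def dist_real_def)
qed

lemma unit_speed_subset: "unit_speed \<sigma> l \<Longrightarrow> k \<le> l \<Longrightarrow> unit_speed \<sigma> k"
  by (auto simp: unit_speed_def)

lemma unit_speed_shift: "unit_speed \<sigma> l \<Longrightarrow> 0 \<le> u \<Longrightarrow> u + k \<le> l \<Longrightarrow> unit_speed (\<lambda>s. \<sigma> (u + s)) k"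
  by (auto simp: unit_speed_def)

lemma unit_speed_reverse: "unit_speed \<sigma> l \<Longrightarrow> 0 \<le> u \<Longrightarrow> u \<le> l \<Longrightarrow> unit_speed (\<lambda>s. \<sigma> (u - s)) u"
  by (auto simp: unit_speed_def abs_minus_commute)

lemma curve_length_ge:
  "sorted ts \<Longrightarrow> set ts \<subseteq> {a..b} \<Longrightarrow>
    ereal (\<Sum>i < length ts - 1. dist (\<gamma> (ts ! i)) (\<gamma> (ts ! Suc i))) \<le> curve_length \<gamma> a b"
  unfolding curve_length_def by (rule SUP_upper) auto

text \<open>On a curve no longer than the distance of its ends, the distance \<open>h\<close> from
  \<open>p\<close> is an arc length parameter. It may be constant on an interval, but the curve is
  constant there too, so any right inverse of \<open>h\<close> reparametrises it.\<close>

lemma shortest_unit_speed: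
  assumes "shortest p q L"
  obtains \<sigma> where "unit_speed \<sigma> (dist p q)" "\<sigma> 0 = p" "\<sigma> (dist p q) = q" "L = \<sigma> ` {0..dist p q}"
proof -
  obtain \<gamma> where \<gamma>: "continuous_on {0..1} \<gamma>" "\<gamma> 0 = p" "\<gamma> 1 = q"
    "curve_length \<gamma> 0 1 = ereal (dist p q)" "L = \<gamma> ` {0..1}"
    using assms unfolding shortest_def by blast
  define h where "h t = dist p (\<gamma> t)" for t
  have *: "dist (\<gamma> u) (\<gamma> v) = h v - h u" if "0 \<le> u" "u \<le> v" "v \<le> 1" for u v
  proof -
    \<comment> \<open>The partition 0, u, v, 1 forces equality in the triangle inequality from
      \<open>p\<close> to \<open>q\<close>.\<close>
    have "ereal (\<Sum>i < length [0,u,v,1] - 1. dist (\<gamma> ([0,u,v,1] ! i)) (\<gamma> ([0,u,v,1] ! Suc i))) \<le> curve_length \<gamma> 0 1"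
      using that by (intro curve_length_ge) auto
    then have "dist p (\<gamma> u) + dist (\<gamma> u) (\<gamma> v) + dist (\<gamma> v) q \<le> dist p q"
      using \<gamma> by (simp add: numeral_3_eq_3 numeral_2_eq_2)
    then show ?thesis
      using dist_triangle[of p q "\<gamma> v"] dist_triangle[of p "\<gamma> v" "\<gamma> u"] by (simp add: h_def)
  qed
  have iso: "dist (\<gamma> u) (\<gamma> v) = \<bar>h u - h v\<bar>" if "u \<in> {0..1}" "v \<in> {0..1}" for u v
    using *[of u v] *[of v u] that zero_le_dist[of "\<gamma> u" "\<gamma> v"]
    by (cases "u \<le> v") (auto simp: dist_commute)
  have "\<exists>u\<in>{0..1}. h u = s" if "s \<in> {0..dist p q}" for s
  proof -
    have "continuous_on {0..1} h" unfolding h_def by (intro continuous_intros \<gamma>)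
    moreover have "h 0 = 0" "h 1 = dist p q" by (auto simp: h_def \<gamma>)
    ultimately show ?thesis using IVT'[of h 0 s 1] that by auto
  qed
  then obtain u where u: "\<And>s. s \<in> {0..dist p q} \<Longrightarrow> u s \<in> {0..1} \<and> h (u s) = s" by metis
  have h: "h t \<in> {0..dist p q}" if "t \<in> {0..1}" for t
    using *[of t 1] that \<gamma> zero_le_dist[of "\<gamma> t" q] by (auto simp: h_def)
  have h01: "h 0 = 0" "h 1 = dist p q" by (auto simp: h_def \<gamma>)
  have param: "\<gamma> (u (h t)) = \<gamma> t" if "t \<in> {0..1}" for t
    using iso[of "u (h t)" t] u[OF h[OF that]] that by simp
  show ?thesis
  proof (rule that[of "\<gamma> \<circ> u"])
    show "unit_speed (\<gamma> \<circ> u) (dist p q)"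
      unfolding unit_speed_def using iso u by simp
    show "(\<gamma> \<circ> u) 0 = p" using param[of 0] h01 \<gamma> by simp
    show "(\<gamma> \<circ> u) (dist p q) = q" using param[of 1] h01 \<gamma> by simp
    have "\<gamma> t \<in> (\<gamma> \<circ> u) ` {0..dist p q}" if "t \<in> {0..1}" for t
      using param[OF that] h[OF that] by (metis comp_apply imageI)
    then show "L = (\<gamma> \<circ> u) ` {0..dist p q}" using u \<gamma> by auto
  qed
qed

lemma unit_speed_shortest:
  assumes \<sigma>: "unit_speed \<sigma> l" and "0 \<le> l"
  shows "shortest (\<sigma> 0) (\<sigma> l) (\<sigma> ` {0..l})"
proof -
  define \<gamma> where "\<gamma> t = \<sigma> (l * t)" for t
  have in_l: "l * t \<in> {0..l}" if "t \<in> {0..1}" for t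
    using that \<open>0 \<le> l\<close> by (auto simp: mult_left_le)
  have dist: "dist (\<gamma> s) (\<gamma> t) = l * \<bar>s - t\<bar>" if "s \<in> {0..1}" "t \<in> {0..1}" for s t
    using \<sigma> in_l[OF that(1)] in_l[OF that(2)] \<open>0 \<le> l\<close>
    by (simp add: unit_speed_def \<gamma>_def abs_mult flip: right_diff_distrib)
  have l: "dist (\<sigma> 0) (\<sigma> l) = l" using \<sigma> \<open>0 \<le> l\<close> by (simp add: unit_speed_def)
  have "continuous_on {0..1} \<gamma>"
    unfolding \<gamma>_def
    by (rule continuous_on_compose2[OF unit_speed_continuous_on[OF \<sigma>]])
      (use in_l in \<open>auto intro!: continuous_on_mult_left continuous_on_id\<close>)
  moreover have "\<gamma> ` {0..1} = \<sigma> ` {0..l}"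
  proof (cases "l = 0")
    case False
    then have "(\<lambda>t. l * t) ` {0..1} = {0..l}" using \<open>0 \<le> l\<close> by (simp add: image_mult_atLeastAtMost)
    then show ?thesis unfolding \<gamma>_def by (metis image_image)
  qed (simp add: \<gamma>_def image_constant_conv)
  moreover have "curve_length \<gamma> 0 1 = ereal l"
  proof (rule antisym)
    show "curve_length \<gamma> 0 1 \<le> ereal l"
      unfolding curve_length_def
    proof (rule SUP_least, clarify)
      fix ts :: "real list" assume ts: "sorted ts" "set ts \<subseteq> {0..1}"
      have nth: "ts ! i \<in> {0..1}" if "i < length ts" for i using ts that nth_mem by blast
      show "ereal (\<Sum>i<length ts - 1. dist (\<gamma> (ts ! i)) (\<gamma> (ts ! Suc i))) \<le> ereal l"
      proof (cases "ts = []")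
        case False
        have "(\<Sum>i<length ts - 1. dist (\<gamma> (ts ! i)) (\<gamma> (ts ! Suc i))) = (\<Sum>i<length ts - 1. l * (ts ! Suc i - ts ! i))"
        proof (rule sum.cong[OF refl])
          fix i assume "i \<in> {..<length ts - 1}"
          then show "dist (\<gamma> (ts ! i)) (\<gamma> (ts ! Suc i)) = l * (ts ! Suc i - ts ! i)"
            using dist[of "ts ! i" "ts ! Suc i"] nth sorted_nth_mono[OF ts(1), of i "Suc i"] by simp
        qed
        also have "\<dots> = l * (ts ! (length ts - 1) - ts ! 0)"
          by (simp add: sum_lessThan_telescope[of "\<lambda>i. ts ! i"] flip: sum_distrib_left)
        also have "\<dots> \<le> l * 1"
          using nth[of 0] nth[of "length ts - 1"] False \<open>0 \<le> l\<close> by (intro mult_left_mono) auto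
        finally show ?thesis by simp
      qed (use \<open>0 \<le> l\<close> in simp)
    qed
    show "ereal l \<le> curve_length \<gamma> 0 1"
      using curve_length_ge[of "[0,1]" 0 1 \<gamma>] dist[of 0 1] by simp
  qed
  ultimately show ?thesis
    unfolding shortest_def l by (intro exI[of _ \<gamma>]) (auto simp: \<gamma>_def)
qed

lemma shortest_segment:
  assumes "unit_speed \<sigma> l" "0 \<le> u" "u \<le> v" "v \<le> l"
  shows "shortest (\<sigma> u) (\<sigma> v) (\<sigma> ` {u..v})" "shortest (\<sigma> v) (\<sigma> u) (\<sigma> ` {u..v})"
proof -
  have "(\<lambda>s. u + s) ` {0..v - u} = {u..v}" using image_add_atLeastAtMost[of u 0 "v - u"] by simp
  then have "(\<lambda>s. \<sigma> (u + s)) ` {0..v - u} = \<sigma> ` {u..v}" by (metis image_image)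
  then show "shortest (\<sigma> u) (\<sigma> v) (\<sigma> ` {u..v})"
    using unit_speed_shortest[OF unit_speed_shift[of \<sigma> l u "v - u"]] assms by simp
  have "(\<lambda>s. v - s) ` {0..v - u} = {u..v}" by (simp add: image_diff_atLeastAtMost)
  then have "(\<lambda>s. \<sigma> (v - s)) ` {0..v - u} = \<sigma> ` {u..v}" by (metis image_image)
  then show "shortest (\<sigma> v) (\<sigma> u) (\<sigma> ` {u..v})"
    using unit_speed_shortest[OF unit_speed_subset[OF unit_speed_reverse[of \<sigma> l v], of "v - u"]] assms by simp
qed

section \<open>Upper angles of unit speed paths and the first variation\<close>

lemma comp_angle_0_bound:
  assumes "0 < a" "0 < b" "a \<le> b + c" "b \<le> a + c" "c \<le> a + b"
  shows "\<bar>(a\<^sup>2 + b\<^sup>2 - c\<^sup>2) / (2 * a * b)\<bar> \<le> (1::real)"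
proof -
  have "0 \<le> c" using assms by linarith
  have "c\<^sup>2 \<le> (a + b)\<^sup>2" using assms \<open>0 \<le> c\<close> by (intro power_mono) auto
  moreover have "(a - b)\<^sup>2 \<le> c\<^sup>2" using assms by (simp add: abs_le_square_iff[symmetric] abs_le_iff)
  ultimately have "\<bar>a\<^sup>2 + b\<^sup>2 - c\<^sup>2\<bar> \<le> 2 * a * b"
    by (simp add: abs_le_iff power2_eq_square algebra_simps)
  then show ?thesis using assms by (simp add: abs_mult field_simps)
qed

lemma angleK_0_arg_bound:
  assumes "V \<noteq> X" "V \<noteq> Y"
  shows "\<bar>((dist V X)\<^sup>2 + (dist V Y)\<^sup>2 - (dist X Y)\<^sup>2) / (2 * dist V X * dist V Y)\<bar> \<le> 1"
  using assms dist_triangle[of V X Y] dist_triangle[of V Y X] dist_triangle[of X Y V]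
  by (intro comp_angle_0_bound) (auto simp: dist_commute)

lemma cos_angleK_0:
  assumes "V \<noteq> X" "V \<noteq> Y"
  shows "cos (angleK 0 X V Y) = ((dist V X)\<^sup>2 + (dist V Y)\<^sup>2 - (dist X Y)\<^sup>2) / (2 * dist V X * dist V Y)"
  unfolding angleK_def comp_angle_def using cos_arccos_abs[OF angleK_0_arg_bound[OF assms]] by simp

lemma angleK_0_bounds:
  assumes "V \<noteq> X" "V \<noteq> Y"
  shows "0 \<le> angleK 0 X V Y" "angleK 0 X V Y \<le> pi"
proof -
  let ?q = "((dist V X)\<^sup>2 + (dist V Y)\<^sup>2 - (dist X Y)\<^sup>2) / (2 * dist V X * dist V Y)"
  have "-1 \<le> ?q" "?q \<le> 1" using angleK_0_arg_bound[OF assms] by linarith+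
  moreover have "angleK 0 X V Y = arccos ?q" by (simp add: angleK_def comp_angle_def)
  ultimately show "0 \<le> angleK 0 X V Y" "angleK 0 X V Y \<le> pi"
    by (simp_all only: arccos_lbound arccos_ubound)
qed

context
  fixes \<sigma> \<tau> :: "real \<Rightarrow> 'a::metric_space" and l m :: real and V :: 'a
  assumes \<sigma>: "unit_speed \<sigma> l" "0 < l" "\<sigma> 0 = V" and \<tau>: "unit_speed \<tau> m" "0 < m" "\<tau> 0 = V"
begin

lemma dist_start: "0 \<le> s \<Longrightarrow> s \<le> l \<Longrightarrow> dist (\<sigma> s) V = s" "0 \<le> t \<Longrightarrow> t \<le> m \<Longrightarrow> dist (\<tau> t) V = t"
  using unit_speedD[OF \<sigma>(1), of s 0] unit_speedD[OF \<tau>(1), of t 0] \<sigma> \<tau> by auto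

text \<open>Passes from neighbourhoods in the product of the two images to a square of parameters.
  The product distance is at most s + t, hence the half radius in the witness.\<close>

lemma eventually_sector:
  assumes "eventually P (at (V, V) within ((\<sigma> ` {0..l} - {V}) \<times> (\<tau> ` {0..m} - {V})))"
  obtains e where "0 < e" "e \<le> l" "e \<le> m" "\<And>s t. 0 < s \<Longrightarrow> s < e \<Longrightarrow> 0 < t \<Longrightarrow> t < e \<Longrightarrow> P (\<sigma> s, \<tau> t)"
proof -
  obtain d where d: "0 < d" and P: "\<And>X. X \<in> (\<sigma> ` {0..l} - {V}) \<times> (\<tau> ` {0..m} - {V}) \<Longrightarrow> X \<noteq> (V, V) \<Longrightarrow> dist X (V, V) < d \<Longrightarrow> P X"
    using assms unfolding eventually_at by blast
  show ?thesis
  proof (rule that[of "min (d / 2) (min l m)"])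
    fix s t assume st: "0 < s" "s < min (d / 2) (min l m)" "0 < t" "t < min (d / 2) (min l m)"
    have "dist (\<sigma> s, \<tau> t) (V, V) = sqrt (s\<^sup>2 + t\<^sup>2)"
      using st by (simp add: dist_Pair_Pair dist_start)
    also have "\<dots> \<le> s + t" using st by (intro sqrt_add_le_add_sqrt[THEN order_trans]) auto
    finally have "dist (\<sigma> s, \<tau> t) (V, V) < d" using st by simp
    moreover have "\<sigma> s \<noteq> V" "\<tau> t \<noteq> V" using st dist_start(1)[of s] dist_start(2)[of t] by auto
    ultimately show "P (\<sigma> s, \<tau> t)" using st by (intro P) auto
  qed (use d \<sigma> \<tau> in auto)
qed

text \<open>Over the trivial filter the limsup would be minus infinity; this is what lets upper
  angles be bounded below by 0.\<close>

lemma sector_nontrivial: "at (V, V) within ((\<sigma> ` {0..l} - {V}) \<times> (\<tau> ` {0..m} - {V})) \<noteq> bot"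
proof
  assume bot: "at (V, V) within ((\<sigma> ` {0..l} - {V}) \<times> (\<tau> ` {0..m} - {V})) = bot"
  show False
  proof (rule eventually_sector[of "\<lambda>_. False"])
    fix e :: real assume "0 < e" "\<And>s t :: real. 0 < s \<Longrightarrow> s < e \<Longrightarrow> 0 < t \<Longrightarrow> t < e \<Longrightarrow> False"
    from this(2)[of "e / 2" "e / 2"] this(1) show False by simp
  qed (simp add: bot)
qed

lemma eventually_in_sector:
  "eventually (\<lambda>X. X \<in> (\<sigma> ` {0..l} - {V}) \<times> (\<tau> ` {0..m} - {V})) (at (V, V) within ((\<sigma> ` {0..l} - {V}) \<times> (\<tau> ` {0..m} - {V})))"
  by (simp add: eventually_at_filter)

lemma upper_angle_real:
  obtains \<alpha> where "upper_angle V (\<sigma> ` {0..l}) (\<tau> ` {0..m}) = ereal \<alpha>" "0 \<le> \<alpha>" "\<alpha> \<le> pi"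
proof -
  have "0 \<le> upper_angle V (\<sigma> ` {0..l}) (\<tau> ` {0..m})"
    unfolding upper_angle_def
    by (rule le_Limsup[OF sector_nontrivial], rule eventually_mono[OF eventually_in_sector])
      (auto intro!: angleK_0_bounds)
  moreover have "upper_angle V (\<sigma> ` {0..l}) (\<tau> ` {0..m}) \<le> ereal pi"
    unfolding upper_angle_def
    by (rule Limsup_bounded, rule eventually_mono[OF eventually_in_sector])
      (auto intro!: angleK_0_bounds)
  ultimately show ?thesis
    using that by (cases "upper_angle V (\<sigma> ` {0..l}) (\<tau> ` {0..m})") auto
qed

text \<open>Equality in the triangle inequality at the far ends passes to all inner points, so every
  single comparison angle equals pi.\<close>

lemma upper_angle_straight:
  assumes "dist (\<sigma> l) (\<tau> m) = l + m"
  shows "upper_angle V (\<sigma> ` {0..l}) (\<tau> ` {0..m}) = ereal pi"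
proof -
  have "angleK 0 X V Y = pi" if "X \<in> \<sigma> ` {0..l} - {V}" "Y \<in> \<tau> ` {0..m} - {V}" for X Y
  proof -
    obtain s t where st: "X = \<sigma> s" "0 \<le> s" "s \<le> l" "Y = \<tau> t" "0 \<le> t" "t \<le> m" using \<open>X \<in> _\<close> \<open>Y \<in> _\<close> by auto
    then have pos: "0 < s" "0 < t" using that \<sigma> \<tau> by (auto simp: less_le)
    have d: "dist V X = s" "dist V Y = t" using st dist_start by (auto simp: dist_commute)
    have "dist (\<sigma> l) X = l - s" "dist Y (\<tau> m) = m - t"
      using unit_speedD[OF \<sigma>(1), of l s] unit_speedD[OF \<tau>(1), of t m] st \<sigma> \<tau> by auto
    then have "dist X Y = s + t"
      using assms dist_triangle[of "\<sigma> l" "\<tau> m" X] dist_triangle[of X "\<tau> m" Y] dist_triangle[of X Y V] d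
      by (simp add: dist_commute)
    then have "((dist V X)\<^sup>2 + (dist V Y)\<^sup>2 - (dist X Y)\<^sup>2) / (2 * dist V X * dist V Y) = -1"
      unfolding d using pos by (simp add: power2_eq_square field_simps)
    then show ?thesis by (simp add: angleK_def comp_angle_def)
  qed
  then have "eventually (\<lambda>X. (case X of (X, Y) \<Rightarrow> ereal (angleK 0 X V Y)) = ereal pi)
      (at (V, V) within ((\<sigma> ` {0..l} - {V}) \<times> (\<tau> ` {0..m} - {V})))"
    by (intro eventually_mono[OF eventually_in_sector]) auto
  then show ?thesis
    unfolding upper_angle_def by (simp add: Limsup_eq Limsup_const[OF sector_nontrivial])
qed

lemma upper_angle_restrict:
  assumes "0 < l'" "l' \<le> l" "0 < m'" "m' \<le> m"
  shows "upper_angle V (\<sigma> ` {0..l'}) (\<tau> ` {0..m'}) = upper_angle V (\<sigma> ` {0..l}) (\<tau> ` {0..m})"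
proof -
  have "at (V, V) within ((\<sigma> ` {0..l'} - {V}) \<times> (\<tau> ` {0..m'} - {V})) =
      at (V, V) within ((\<sigma> ` {0..l} - {V}) \<times> (\<tau> ` {0..m} - {V}))"
  proof (rule at_within_nhd)
    show "open (ball V l' \<times> ball V m')" by (intro open_Times open_ball)
    have "\<sigma> s \<in> \<sigma> ` {0..l'}" if "0 \<le> s" "s \<le> l" "dist V (\<sigma> s) < l'" for s
      using that dist_start(1)[of s] by (auto simp: dist_commute)
    moreover have "\<tau> s \<in> \<tau> ` {0..m'}" if "0 \<le> s" "s \<le> m" "dist V (\<tau> s) < m'" for s
      using that dist_start(2)[of s] by (auto simp: dist_commute)
    ultimately have "(\<sigma> ` {0..l} \<inter> ball V l') \<subseteq> \<sigma> ` {0..l'}" "(\<tau> ` {0..m} \<inter> ball V m') \<subseteq> \<tau> ` {0..m'}" by auto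
    moreover have "\<sigma> ` {0..l'} \<subseteq> \<sigma> ` {0..l}" "\<tau> ` {0..m'} \<subseteq> \<tau> ` {0..m}" using assms by auto
    ultimately show "(\<sigma> ` {0..l'} - {V}) \<times> (\<tau> ` {0..m'} - {V}) \<inter> (ball V l' \<times> ball V m') - {(V, V)} =
        (\<sigma> ` {0..l} - {V}) \<times> (\<tau> ` {0..m} - {V}) \<inter> (ball V l' \<times> ball V m') - {(V, V)}" by blast
  qed (use assms in auto)
  then show ?thesis unfolding upper_angle_def by simp
qed

text \<open>The Euclidean law of cosines is applied to one fixed point \<open>\<tau> \<rho>\<close>
  close to the vertex, and the triangle inequality covers the rest of the way to
  \<open>\<tau> m\<close>. The alternative \<open>c = pi\<close> serves upper angles equal to pi,
  above which no admissible \<open>c\<close> is left; there the estimate is the triangle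
  inequality.\<close>

lemma first_variation:
  assumes "upper_angle V (\<sigma> ` {0..l}) (\<tau> ` {0..m}) < ereal c \<or> c = pi" "0 \<le> c" "c \<le> pi"
  obtains e \<rho> where "0 < e" "e \<le> l" "0 < \<rho>"
    "\<And>s. 0 < s \<Longrightarrow> s < e \<Longrightarrow> dist (\<sigma> s) (\<tau> m) \<le> m - s * cos c + s\<^sup>2 / (2 * \<rho>)"
proof (cases "c = pi")
  case True
  show ?thesis
  proof (rule that[of l 1])
    fix s assume "0 < s" "s < l"
    then have "dist (\<sigma> s) (\<tau> m) \<le> s + m"
      using dist_triangle[of "\<sigma> s" "\<tau> m" V] dist_start(1)[of s] dist_start(2)[of m] \<tau> by (simp add: dist_commute)
    then show "dist (\<sigma> s) (\<tau> m) \<le> m - s * cos c + s\<^sup>2 / (2 * 1)"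
      using True by (simp add: add_increasing2 add.commute)
  qed (use \<sigma> in auto)
next
  case False
  then have "Limsup (at (V, V) within ((\<sigma> ` {0..l} - {V}) \<times> (\<tau> ` {0..m} - {V}))) (\<lambda>(X, Y). ereal (angleK 0 X V Y)) < ereal c"
    using assms unfolding upper_angle_def by simp
  from Limsup_lessD[OF this] obtain e where e: "0 < e" "e \<le> l" "e \<le> m"
    "\<And>s t. 0 < s \<Longrightarrow> s < e \<Longrightarrow> 0 < t \<Longrightarrow> t < e \<Longrightarrow> angleK 0 (\<sigma> s) V (\<tau> t) < c"
    by (rule eventually_sector) auto
  define \<rho> where "\<rho> = e / 2"
  have \<rho>: "0 < \<rho>" "\<rho> < e" "\<rho> \<le> m" using e by (auto simp: \<rho>_def)
  show ?thesis
  proof (rule that[OF e(1,2) \<rho>(1)])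
    fix s assume s: "0 < s" "s < e"
    have ne: "V \<noteq> \<sigma> s" "V \<noteq> \<tau> \<rho>"
      using s e \<rho> dist_start(1)[of s] dist_start(2)[of \<rho>] by auto
    have d: "dist V (\<sigma> s) = s" "dist V (\<tau> \<rho>) = \<rho>"
      using s e \<rho> dist_start(1)[of s] dist_start(2)[of \<rho>] by (auto simp: dist_commute)
    have "cos c < cos (angleK 0 (\<sigma> s) V (\<tau> \<rho>))"
      using e(4)[OF s \<rho>(1,2)] angleK_0_bounds[OF ne] assms by (intro cos_monotone_0_pi) auto
    then have "cos c * (2 * s * \<rho>) < s\<^sup>2 + \<rho>\<^sup>2 - (dist (\<sigma> s) (\<tau> \<rho>))\<^sup>2"
      unfolding cos_angleK_0[OF ne] d using s \<rho> by (simp add: less_divide_eq)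
    \<comment> \<open>The square of \<open>r\<close> exceeds the law of cosines value by a perfect
      square, so \<open>r\<close> bounds the distance as soon as it is nonnegative.\<close>
    moreover define r where "r = \<rho> - s * cos c + s\<^sup>2 / (2 * \<rho>)"
    have "r\<^sup>2 = s\<^sup>2 + \<rho>\<^sup>2 - cos c * (2 * s * \<rho>) + (s\<^sup>2 / (2 * \<rho>) - s * cos c)\<^sup>2"
      using \<rho> unfolding r_def by (simp add: power2_eq_square field_simps)
    ultimately have "(dist (\<sigma> s) (\<tau> \<rho>))\<^sup>2 \<le> r\<^sup>2"
      using zero_le_power2[of "s\<^sup>2 / (2 * \<rho>) - s * cos c"] by linarith
    moreover have "0 \<le> r"
    proof -
      have "s * cos c \<le> s" using s by (simp add: mult_left_le)
      moreover have "2 * s * \<rho> \<le> 2 * \<rho>\<^sup>2 + s\<^sup>2" using sum_squares_bound[of s \<rho>] zero_le_power2[of \<rho>] by linarith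
      then have "s \<le> \<rho> + s\<^sup>2 / (2 * \<rho>)" using \<rho> by (simp add: field_simps power2_eq_square)
      ultimately show ?thesis by (simp add: r_def)
    qed
    ultimately have "dist (\<sigma> s) (\<tau> \<rho>) \<le> r" by (rule power2_le_imp_le)
    moreover have "dist (\<tau> \<rho>) (\<tau> m) = m - \<rho>" using unit_speedD[OF \<tau>(1), of \<rho> m] \<rho> \<tau> by simp
    ultimately show "dist (\<sigma> s) (\<tau> m) \<le> m - s * cos c + s\<^sup>2 / (2 * \<rho>)"
      using dist_triangle[of "\<sigma> s" "\<tau> m" "\<tau> \<rho>"] by (simp add: r_def)
  qed
qed

end

text \<open>If the angles added up to less than pi, a short move along \<open>\<sigma>\<close> would
  bring the point closer to the two ends in total than the straight connection allows.\<close>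

lemma adjacent_upper_angles:
  assumes \<sigma>: "unit_speed \<sigma> l" "0 < l" "\<sigma> 0 = V" and \<tau>1: "unit_speed \<tau>\<^sub>1 m\<^sub>1" "0 < m\<^sub>1" "\<tau>\<^sub>1 0 = V"
    and \<tau>2: "unit_speed \<tau>\<^sub>2 m\<^sub>2" "0 < m\<^sub>2" "\<tau>\<^sub>2 0 = V" and straight: "dist (\<tau>\<^sub>1 m\<^sub>1) (\<tau>\<^sub>2 m\<^sub>2) = m\<^sub>1 + m\<^sub>2"
    and \<phi>: "upper_angle V (\<sigma> ` {0..l}) (\<tau>\<^sub>1 ` {0..m\<^sub>1}) = ereal \<phi>\<^sub>1" "0 \<le> \<phi>\<^sub>1"
      "upper_angle V (\<sigma> ` {0..l}) (\<tau>\<^sub>2 ` {0..m\<^sub>2}) = ereal \<phi>\<^sub>2" "0 \<le> \<phi>\<^sub>2"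
  shows "pi \<le> \<phi>\<^sub>1 + \<phi>\<^sub>2"
proof (rule ccontr)
  assume "\<not> ?thesis"
  define \<delta> where "\<delta> = (pi - (\<phi>\<^sub>1 + \<phi>\<^sub>2)) / 3"
  have \<delta>: "0 < \<delta>" "\<phi>\<^sub>1 + \<delta> + (\<phi>\<^sub>2 + \<delta>) < pi" using \<open>\<not> _\<close> unfolding \<delta>_def by (simp_all add: field_simps)
  define C where "C = cos (\<phi>\<^sub>1 + \<delta>) + cos (\<phi>\<^sub>2 + \<delta>)"
  have "cos (pi - (\<phi>\<^sub>2 + \<delta>)) < cos (\<phi>\<^sub>1 + \<delta>)" using \<delta> \<phi> by (intro cos_monotone_0_pi) auto
  then have C: "0 < C" by (simp add: C_def)
  obtain e1 r1 where 1: "0 < e1" "0 < r1"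
    "\<And>s. 0 < s \<Longrightarrow> s < e1 \<Longrightarrow> dist (\<sigma> s) (\<tau>\<^sub>1 m\<^sub>1) \<le> m\<^sub>1 - s * cos (\<phi>\<^sub>1 + \<delta>) + s\<^sup>2 / (2 * r1)"
    by (rule first_variation[OF \<sigma> \<tau>1, of "\<phi>\<^sub>1 + \<delta>"]) (use \<delta> \<phi> in auto)
  obtain e2 r2 where 2: "0 < e2" "0 < r2"
    "\<And>s. 0 < s \<Longrightarrow> s < e2 \<Longrightarrow> dist (\<sigma> s) (\<tau>\<^sub>2 m\<^sub>2) \<le> m\<^sub>2 - s * cos (\<phi>\<^sub>2 + \<delta>) + s\<^sup>2 / (2 * r2)"
    by (rule first_variation[OF \<sigma> \<tau>2, of "\<phi>\<^sub>2 + \<delta>"]) (use \<delta> \<phi> in auto)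
  define R where "R = 1 / (2 * r1) + 1 / (2 * r2)"
  have R: "0 < R" using 1 2 by (simp add: R_def add_pos_pos)
  \<comment> \<open>Small enough that the first order gain \<open>s * C\<close> beats the quadratic
    error \<open>s * (s * R)\<close>.\<close>
  define s where "s = min (min e1 e2) (C / R) / 2"
  have s: "0 < s" "s < e1" "s < e2" using 1 2 C R by (auto simp: s_def)
  have "s * R < C"
  proof -
    have "0 < C / R" using C R by simp
    moreover have "2 * s \<le> C / R" unfolding s_def by simp
    ultimately have "s < C / R" by linarith
    then show ?thesis using R by (simp add: less_divide_eq)
  qed
  have "m\<^sub>1 + m\<^sub>2 \<le> dist (\<sigma> s) (\<tau>\<^sub>1 m\<^sub>1) + dist (\<sigma> s) (\<tau>\<^sub>2 m\<^sub>2)"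
    using dist_triangle2[of "\<tau>\<^sub>1 m\<^sub>1" "\<tau>\<^sub>2 m\<^sub>2" "\<sigma> s"] straight by (simp add: dist_commute)
  also have "\<dots> \<le> m\<^sub>1 + m\<^sub>2 - s * C + s * (s * R)"
    using 1(3)[OF s(1,2)] 2(3)[OF s(1,3)] unfolding C_def R_def by (simp add: algebra_simps power2_eq_square)
  finally have "s * C \<le> s * (s * R)" by simp
  then show False using \<open>s * R < C\<close> s by simp
qed

section \<open>Angle comparison\<close>

text \<open>This is the perimeter bound for the degenerate triangle A, B, B.\<close>

lemma RK_dist_less:
  fixes A B :: "'a::metric_space"
  assumes "RK_domain K TYPE('a)" "K > 0"
  shows "dist A B < pi / sqrt K"
proof -
  have "dist A B + dist B B + dist B A < 2 * pi / sqrt K"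
    using assms unfolding RK_domain_def by blast
  then show ?thesis by (simp add: dist_commute)
qed

lemma RK_perimeter:
  fixes A B C :: "'a::metric_space"
  assumes "RK_domain K TYPE('a)" "K > 0"
  shows "dist A B + dist B C + dist C A < 2 * pi / sqrt K"
  using assms unfolding RK_domain_def by blast

lemma RK_shortest:
  fixes p q :: "'a::metric_space"
  assumes "RK_domain K TYPE('a)"
  obtains L where "shortest p q L"
proof -
  have "\<forall>p q :: 'a. \<exists>L. shortest p q L" using assms unfolding RK_domain_def by (elim conjE)
  then show ?thesis using that by metis
qed

lemma RK_upper_angle_sum:
  fixes A B C :: "'a::metric_space"
  assumes RK: "RK_domain K TYPE('a)" and "A \<noteq> B" "B \<noteq> C" "A \<noteq> C"
    and "shortest A B LAB" "shortest B C LBC" "shortest C A LCA"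
  shows "upper_angle A LAB LCA + upper_angle B LAB LBC + upper_angle C LCA LBC
    \<le> ereal (angleK K B A C + angleK K A B C + angleK K A C B)"
proof -
  have "\<forall>A B C :: 'a. \<forall>LAB LBC LCA. A \<noteq> B \<and> B \<noteq> C \<and> A \<noteq> C \<and>
        shortest A B LAB \<and> shortest B C LBC \<and> shortest C A LCA \<longrightarrow>
        upper_angle A LAB LCA + upper_angle B LAB LBC + upper_angle C LCA LBC
          \<le> ereal (angleK K B A C + angleK K A B C + angleK K A C B)"
    using RK unfolding RK_domain_def by (elim conjE)
  then show ?thesis using assms(2-7) by simp
qed

lemma cos_angleK:
  fixes V X Y :: "'a::metric_space"
  assumes "K \<noteq> 0" "RK_domain K TYPE('a)" "V \<noteq> X" "V \<noteq> Y"
  shows "cos (angleK K X V Y) = (cs K (dist X Y) - cs K (dist V X) * cs K (dist V Y)) / (K * (sn K (dist V X) * sn K (dist V Y)))"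
    and "0 \<le> angleK K X V Y" "angleK K X V Y \<le> pi"
    and "\<bar>(cs K (dist X Y) - cs K (dist V X) * cs K (dist V Y)) / (K * (sn K (dist V X) * sn K (dist V Y)))\<bar> \<le> 1"
proof -
  let ?q = "(cs K (dist X Y) - cs K (dist V X) * cs K (dist V Y)) / (K * (sn K (dist V X) * sn K (dist V Y)))"
  show b: "\<bar>?q\<bar> \<le> 1"
    using assms RK_dist_less[OF assms(2)] RK_perimeter[OF assms(2), of V X Y]
      dist_triangle[of V X Y] dist_triangle[of V Y X] dist_triangle[of X Y V]
    by (intro comp_angle_bound) (auto simp: dist_commute add.commute add.left_commute)
  then have b': "-1 \<le> ?q" "?q \<le> 1" by linarith+
  have q: "angleK K X V Y = arccos ?q" by (simp add: angleK_def comp_angle_eq assms(1))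
  show "cos (angleK K X V Y) = ?q" unfolding q by (rule cos_arccos_abs[OF b])
  show "0 \<le> angleK K X V Y" "angleK K X V Y \<le> pi" unfolding q using b' by (simp_all only: arccos_lbound arccos_ubound)
qed

lemma comp_angle_degenerate:
  assumes "K \<noteq> 0" "0 < sn K p" "0 < sn K q"
  shows "comp_angle K p q (p + q) = pi" "comp_angle K p q (p - q) = 0" "comp_angle K p q (q - p) = 0"
proof -
  have p: "sn K p \<noteq> 0" "sn K q \<noteq> 0" using assms by auto
  have "cs K (p + q) - cs K p * cs K q = - (K * (sn K p * sn K q))"
    "cs K (p - q) - cs K p * cs K q = K * (sn K p * sn K q)"
    "cs K (q - p) - cs K p * cs K q = K * (sn K p * sn K q)"
    using assms(1) by (simp_all add: cs_add cs_diff mult.commute)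
  then show "comp_angle K p q (p + q) = pi" "comp_angle K p q (p - q) = 0" "comp_angle K p q (q - p) = 0"
    unfolding comp_angle_eq[OF assms(1)] using p assms(1) by simp_all
qed

lemma reverse_image: "(\<lambda>s. \<sigma> (l - s)) ` {0..l} = \<sigma> ` {0..l}" for l :: real
proof -
  have "(\<lambda>s. l - s) ` {0..l} = {0..l}" by (simp add: image_diff_atLeastAtMost)
  then show ?thesis by (metis image_image)
qed

text \<open>The angle sum condition in the form required by the first variation: at each vertex both
  sides are unit speed paths starting there, and the angles are real numbers.\<close>

lemma RK_angle_sum:
  fixes \<sigma> \<tau> :: "real \<Rightarrow> 'a::metric_space"
  assumes RK: "RK_domain K TYPE('a)"
    and \<sigma>: "unit_speed \<sigma> x" "0 < x" "\<sigma> 0 = V" and \<tau>: "unit_speed \<tau> y" "0 < y" "\<tau> 0 = V"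
    and ne: "\<sigma> x \<noteq> \<tau> y" and \<alpha>: "upper_angle V (\<sigma> ` {0..x}) (\<tau> ` {0..y}) = ereal \<alpha>"
  obtains \<eta> \<phi> \<psi> where "unit_speed \<eta> (dist (\<sigma> x) (\<tau> y))" "\<eta> 0 = \<sigma> x" "\<eta> (dist (\<sigma> x) (\<tau> y)) = \<tau> y"
    "upper_angle (\<sigma> x) ((\<lambda>s. \<sigma> (x - s)) ` {0..x}) (\<eta> ` {0..dist (\<sigma> x) (\<tau> y)}) = ereal \<phi>" "0 \<le> \<phi>"
    "upper_angle (\<tau> y) ((\<lambda>s. \<tau> (y - s)) ` {0..y}) ((\<lambda>s. \<eta> (dist (\<sigma> x) (\<tau> y) - s)) ` {0..dist (\<sigma> x) (\<tau> y)}) = ereal \<psi>" "0 \<le> \<psi>"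
    "\<alpha> + \<phi> + \<psi> \<le> angleK K (\<sigma> x) V (\<tau> y) + angleK K V (\<sigma> x) (\<tau> y) + angleK K V (\<tau> y) (\<sigma> x)"
proof -
  define X Y z where "X = \<sigma> x" and "Y = \<tau> y" and "z = dist X Y"
  have z: "0 < z" using ne by (simp add: z_def X_def Y_def)
  obtain M where M: "shortest X Y M" by (rule RK_shortest[OF RK])
  obtain \<eta> where \<eta>: "unit_speed \<eta> z" "\<eta> 0 = X" "\<eta> z = Y" "M = \<eta> ` {0..z}"
    by (rule shortest_unit_speed[OF M, folded z_def])
  have L: "shortest V X (\<sigma> ` {0..x})" and N: "shortest Y V (\<tau> ` {0..y})"
    using shortest_segment(1)[OF \<sigma>(1), of 0 x] shortest_segment(2)[OF \<tau>(1), of 0 y] \<sigma>(2,3) \<tau>(2,3)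
    by (simp_all add: X_def Y_def)
  have "dist V X = x" "dist V Y = y"
    using unit_speedD[OF \<sigma>(1), of 0 x] unit_speedD[OF \<tau>(1), of 0 y] \<sigma>(2,3) \<tau>(2,3) by (simp_all add: X_def Y_def)
  then have "V \<noteq> X" "V \<noteq> Y" using \<sigma> \<tau> by auto
  then have sum: "upper_angle V (\<sigma> ` {0..x}) (\<tau> ` {0..y}) + upper_angle X (\<sigma> ` {0..x}) M + upper_angle Y (\<tau> ` {0..y}) M
      \<le> ereal (angleK K X V Y + angleK K V X Y + angleK K V Y X)"
    by (intro RK_upper_angle_sum[OF RK _ _ _ L M N]) (use ne in \<open>simp_all add: X_def Y_def\<close>)
  have r\<sigma>: "unit_speed (\<lambda>s. \<sigma> (x - s)) x" and r\<tau>: "unit_speed (\<lambda>s. \<tau> (y - s)) y" and r\<eta>: "unit_speed (\<lambda>s. \<eta> (z - s)) z"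
    using unit_speed_reverse[OF \<sigma>(1), of x] unit_speed_reverse[OF \<tau>(1), of y] unit_speed_reverse[OF \<eta>(1), of z] \<sigma>(2) \<tau>(2) z by simp_all
  obtain \<phi> where \<phi>: "upper_angle X ((\<lambda>s. \<sigma> (x - s)) ` {0..x}) (\<eta> ` {0..z}) = ereal \<phi>" "0 \<le> \<phi>"
    by (rule upper_angle_real[OF r\<sigma> \<sigma>(2) _ \<eta>(1) z \<eta>(2)]) (auto simp: X_def)
  obtain \<psi> where \<psi>: "upper_angle Y ((\<lambda>s. \<tau> (y - s)) ` {0..y}) ((\<lambda>s. \<eta> (z - s)) ` {0..z}) = ereal \<psi>" "0 \<le> \<psi>"
    by (rule upper_angle_real[OF r\<tau> \<tau>(2) _ r\<eta> z]) (auto simp: Y_def \<eta>)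
  show ?thesis
  proof (rule that[of \<eta> \<phi> \<psi>, folded X_def Y_def, folded z_def])
    show "\<alpha> + \<phi> + \<psi> \<le> angleK K X V Y + angleK K V X Y + angleK K V Y X"
      using sum \<phi>(1) \<psi>(1) \<alpha> unfolding reverse_image \<eta>(4) by simp
  qed (fact \<eta> \<phi> \<psi>)+
qed

text \<open>The shorter side followed by the third side is as long as the longer side, so the upper
  angle where they meet is pi. The comparison angles are 0, 0 and pi, and the angle sum leaves
  nothing for \<open>\<alpha>\<close>.\<close>

lemma upper_angle_degenerate:
  fixes \<sigma> \<tau> :: "real \<Rightarrow> 'a::metric_space"
  assumes K: "K \<noteq> 0" and RK: "RK_domain K TYPE('a)"
    and \<sigma>: "unit_speed \<sigma> x" "0 < x" "\<sigma> 0 = V" and \<tau>: "unit_speed \<tau> y" "0 < y" "\<tau> 0 = V"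
    and ne: "\<sigma> x \<noteq> \<tau> y" and \<alpha>: "upper_angle V (\<sigma> ` {0..x}) (\<tau> ` {0..y}) = ereal \<alpha>"
    and deg: "dist (\<sigma> x) (\<tau> y) = \<bar>x - y\<bar>"
  shows "\<alpha> \<le> 0"
proof -
  define X Y z where "X = \<sigma> x" and "Y = \<tau> y" and "z = dist X Y"
  have z: "0 < z" "z = \<bar>x - y\<bar>"
    unfolding z_def X_def Y_def using ne deg zero_less_dist_iff by blast+
  have d: "dist V X = x" "dist V Y = y" "dist X V = x" "dist Y V = y" "dist X Y = z" "dist Y X = z"
    using unit_speedD[OF \<sigma>(1), of 0 x] unit_speedD[OF \<tau>(1), of 0 y] \<sigma> \<tau> by (auto simp: X_def Y_def z_def dist_commute)
  have sn: "0 < sn K x" "0 < sn K y" "0 < sn K z"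
    using K \<sigma> \<tau> z(1) RK_dist_less[OF RK, of V X] RK_dist_less[OF RK, of V Y] RK_dist_less[OF RK, of X Y]
    unfolding d by (auto intro!: sn_pos)
  obtain \<eta> \<phi> \<psi> where \<eta>: "unit_speed \<eta> z" "\<eta> 0 = X" "\<eta> z = Y"
    and \<phi>: "upper_angle X ((\<lambda>s. \<sigma> (x - s)) ` {0..x}) (\<eta> ` {0..z}) = ereal \<phi>" "0 \<le> \<phi>"
    and \<psi>: "upper_angle Y ((\<lambda>s. \<tau> (y - s)) ` {0..y}) ((\<lambda>s. \<eta> (z - s)) ` {0..z}) = ereal \<psi>" "0 \<le> \<psi>"
    and sum: "\<alpha> + \<phi> + \<psi> \<le> angleK K X V Y + angleK K V X Y + angleK K V Y X"
    using RK_angle_sum[OF RK \<sigma> \<tau> ne \<alpha>] unfolding X_def Y_def z_def by metis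
  have r\<sigma>: "unit_speed (\<lambda>s. \<sigma> (x - s)) x" and r\<tau>: "unit_speed (\<lambda>s. \<tau> (y - s)) y" and r\<eta>: "unit_speed (\<lambda>s. \<eta> (z - s)) z"
    using unit_speed_reverse[OF \<sigma>(1), of x] unit_speed_reverse[OF \<tau>(1), of y] unit_speed_reverse[OF \<eta>(1), of z] \<sigma>(2) \<tau>(2) z by simp_all
  note angle = angleK_def[of K] d
  show ?thesis
  proof (cases "x < y")
    case True
    then have y: "y = x + z" using z by simp
    have "upper_angle X ((\<lambda>s. \<sigma> (x - s)) ` {0..x}) (\<eta> ` {0..z}) = ereal pi"
      by (rule upper_angle_straight[OF r\<sigma> \<sigma>(2) _ \<eta>(1) z(1) \<eta>(2)]) (use \<sigma> \<eta> d y in \<open>auto simp: X_def\<close>)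
    then have "\<phi> = pi" using \<phi> by simp
    moreover have "angleK K X V Y = 0" "angleK K V X Y = pi" "angleK K V Y X = 0"
      unfolding angle using comp_angle_degenerate[OF K sn(1,2)] comp_angle_degenerate[OF K sn(1,3)] comp_angle_degenerate[OF K sn(2,3)]
      unfolding y by simp_all
    ultimately show ?thesis using sum \<psi> by simp
  next
    case False
    then have x: "x = y + z" using z by simp
    have "upper_angle Y ((\<lambda>s. \<tau> (y - s)) ` {0..y}) ((\<lambda>s. \<eta> (z - s)) ` {0..z}) = ereal pi"
      by (rule upper_angle_straight[OF r\<tau> \<tau>(2) _ r\<eta> z(1)]) (use \<tau> \<eta> d x in \<open>auto simp: Y_def\<close>)
    then have "\<psi> = pi" using \<psi> by simp
    moreover have "angleK K X V Y = 0" "angleK K V X Y = 0" "angleK K V Y X = pi"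
      unfolding angle using comp_angle_degenerate[OF K sn(1,2)] comp_angle_degenerate[OF K sn(1,3)] comp_angle_degenerate[OF K sn(2,3)]
      unfolding x by simp_all
    ultimately show ?thesis using sum \<phi> by simp
  qed
qed

text \<open>The side \<open>x\<close> is shortened by \<open>s\<close>. The first variation bounds the opposite side \<open>z' s\<close> from
  above, minimality of the penalised angle bounds the enclosed angle \<open>\<gamma>' s\<close> from below.\<close>
lemma penalised_first_variation:
  fixes z' \<gamma>' :: "real \<Rightarrow> real"
  assumes K: "K \<noteq> 0" and x: "0 < x" "0 < sn K x" "K > 0 \<Longrightarrow> x < pi / sqrt K" and y: "0 < sn K y"
    and z: "0 < z" "K > 0 \<Longrightarrow> z < pi / sqrt K"
    and cz: "cs K z = cs K x * cs K y + K * (sn K x * sn K y * cos \<gamma>)" and \<gamma>: "0 < \<gamma>" "\<gamma> < pi"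
    and \<epsilon>: "0 \<le> \<epsilon>" and M: "sn K x \<le> x * M"
    and e: "0 < e" "e \<le> x" and \<rho>: "0 < \<rho>"
    and z': "\<And>s. 0 < s \<Longrightarrow> s < e \<Longrightarrow> 0 \<le> z' s \<and> z' s \<le> z - s * cos c + s\<^sup>2 / (2 * \<rho>)"
    and \<gamma>': "\<And>s. 0 < s \<Longrightarrow> s < e \<Longrightarrow> \<gamma> + \<epsilon> * ln ((x - s) / x) \<le> \<gamma>' s \<and> \<gamma>' s \<le> pi"
    and cz': "\<And>s. 0 < s \<Longrightarrow> s < e \<Longrightarrow> cs K (z' s) = cs K (x - s) * cs K y + K * (sn K (x - s) * sn K y * cos (\<gamma>' s))"
  shows "cos c \<le> (cs K y - cs K x * cs K z) / (K * (sn K x * sn K z)) + \<epsilon> * M"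
proof -
  define r \<theta> where "r s = z - s * cos c + s\<^sup>2 / (2 * \<rho>)" and "\<theta> s = \<gamma> + \<epsilon> * ln ((x - s) / x)" for s
  \<comment> \<open>\<open>r\<close> bounds the varied side from above and \<open>\<theta>\<close>
    bounds the varied angle from below. \<open>H\<close> is the law of cosines with both bounds
    inserted: it vanishes at 0 and is nonpositive to the right of 0, so its derivative
    \<open>D\<close> there is nonpositive.\<close>
  define H where "H s = K * cs K (r s) - (K * (cs K (x - s) * cs K y) + K * (K * (sn K (x - s) * sn K y * cos (\<theta> s))))" for s
  define D where "D = K * (- K * sn K z * - cos c) -
    (K * (K * sn K x * cs K y) + K * (K * (sn K y * (- cs K x * cos \<gamma> + sn K x * (sin \<gamma> * (\<epsilon> / x))))))"
  have D: "(H has_real_derivative D) (at 0)"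
  proof -
    have r: "(r has_real_derivative - cos c) (at 0)"
      unfolding r_def using \<rho> by (auto intro!: derivative_eq_intros)
    have \<theta>: "(\<theta> has_real_derivative - \<epsilon> / x) (at 0)"
      unfolding \<theta>_def using x by (auto intro!: derivative_eq_intros simp: field_simps)
    have m: "((\<lambda>s. x - s) has_real_derivative -1) (at 0)" by (auto intro!: derivative_eq_intros)
    have 1: "((\<lambda>s. cs K (r s)) has_real_derivative - K * sn K (r 0) * - cos c) (at 0)"
      by (rule DERIV_chain2[OF has_field_derivative_cs[OF K] r])
    have 2: "((\<lambda>s. cs K (x - s)) has_real_derivative - K * sn K (x - 0) * -1) (at 0)"
      by (rule DERIV_chain2[OF has_field_derivative_cs[OF K] m])
    have 3: "((\<lambda>s. sn K (x - s)) has_real_derivative cs K (x - 0) * -1) (at 0)"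
      by (rule DERIV_chain2[OF has_field_derivative_sn[OF K] m])
    have 4: "((\<lambda>s. cos (\<theta> s)) has_real_derivative - sin (\<theta> 0) * (- \<epsilon> / x)) (at 0)"
      by (rule DERIV_chain2[OF DERIV_cos \<theta>])
    have at_0: "r 0 = z" "\<theta> 0 = \<gamma>" using x by (simp_all add: r_def \<theta>_def)
    show ?thesis
      unfolding H_def
      by (rule DERIV_cong, (rule DERIV_diff DERIV_add DERIV_cmult DERIV_cmult_right DERIV_mult 1 2 3 4)+)
        (simp add: D_def at_0 algebra_simps)
  qed
  have "H 0 = 0" using cz x by (simp add: H_def r_def \<theta>_def algebra_simps)
  have ev: "eventually (\<lambda>s. H s \<le> 0) (at_right 0)"
  proof -
    have "isCont \<theta> 0" "isCont r 0"
      unfolding \<theta>_def r_def using x \<rho> by (auto intro!: continuous_intros)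
    then have lim: "(\<theta> \<longlongrightarrow> \<gamma>) (at_right 0)" "(r \<longlongrightarrow> z) (at_right 0)"
      using x by (auto simp: isCont_def \<theta>_def r_def intro: filterlim_at_split[THEN iffD1, THEN conjunct2])
    have "eventually (\<lambda>s. 0 < \<theta> s) (at_right 0)" using order_tendstoD(1)[OF lim(1) \<gamma>(1)] .
    moreover have "eventually (\<lambda>s. below_diam K (r s)) (at_right 0)"
    proof (cases "K > 0")
      case True
      show ?thesis using order_tendstoD(2)[OF lim(2) z(2)[OF True]] by eventually_elim (simp add: below_diam_def)
    qed (simp add: below_diam_def)
    moreover have "eventually (\<lambda>s. 0 < s \<and> s < e) (at_right 0)"
      using e(1) by (auto simp: eventually_at_right_field)
    ultimately show ?thesis
    proof eventually_elim
      case (elim s)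
      then have s: "0 < s" "s < e" by auto
      have "K * cs K (r s) \<le> K * cs K (z' s)"
        using z'[OF s] elim K by (intro cs_antimono) (auto simp: r_def)
      also have "\<dots> = K * (cs K (x - s) * cs K y) + (K * K * (sn K (x - s) * sn K y)) * cos (\<gamma>' s)"
        unfolding cz'[OF s] by (simp add: algebra_simps)
      also have "(K * K * (sn K (x - s) * sn K y)) * cos (\<gamma>' s) \<le> (K * K * (sn K (x - s) * sn K y)) * cos (\<theta> s)"
      proof (rule mult_left_mono)
        show "cos (\<gamma>' s) \<le> cos (\<theta> s)"
          using \<gamma>'[OF s] elim by (intro cos_monotone_0_pi_le) (auto simp: \<theta>_def)
        have "0 \<le> sn K (x - s)" using s e x K by (intro less_imp_le[OF sn_pos]) auto
        then show "0 \<le> K * K * (sn K (x - s) * sn K y)" using y by (intro mult_nonneg_nonneg[OF zero_le_square mult_nonneg_nonneg]) auto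
      qed
      finally show ?case by (simp add: H_def algebra_simps)
    qed
  qed
  have "D \<le> 0"
  proof (rule ccontr)
    assume "\<not> ?thesis"
    then obtain d where d: "0 < d" "\<And>h. 0 < h \<Longrightarrow> h < d \<Longrightarrow> H 0 < H (0 + h)"
      using DERIV_pos_inc_right[OF D] by force
    have "eventually (\<lambda>s. 0 < s \<and> s < d) (at_right (0::real))"
      using d(1) by (auto simp: eventually_at_right_field)
    then have "eventually (\<lambda>s. False) (at_right (0::real))"
      using ev by eventually_elim (use d \<open>H 0 = 0\<close> in force)
    then show False by simp
  qed
  \<comment> \<open>\<open>S\<close> is \<open>sn K z\<close> times the cosine of the angle between
    the sides \<open>x\<close> and \<open>z\<close>, and \<open>sn K y * sin \<gamma>\<close> is the
    height over the side \<open>x\<close>. Their squares add up to that of \<open>sn K z\<close>, so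
    the height in the error term can be replaced by \<open>sn K z\<close>.\<close>
  define S where "S = sn K x * cs K y - cs K x * sn K y * cos \<gamma>"
  have D': "D = (K * K) * (sn K z * cos c - S - sn K x * \<epsilon> / x * (sn K y * sin \<gamma>))"
    unfolding D_def S_def using x by (simp add: field_simps)
  have "0 < K * K" using K not_real_square_gt_zero by blast
  then have le: "sn K z * cos c \<le> S + sn K x * \<epsilon> / x * (sn K y * sin \<gamma>)"
    using \<open>D \<le> 0\<close> mult_pos_pos[of "K * K"] unfolding D' by (smt (verit))
  have sz: "0 < sn K z" using K z by (intro sn_pos) auto
  have sg: "(sin \<gamma>)\<^sup>2 + (cos \<gamma>)\<^sup>2 = 1" by simp
  have "K * (sn K z)\<^sup>2 = K * (S\<^sup>2 + (sn K y * sin \<gamma>)\<^sup>2)"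
    using cz cs_sq_add[OF K, of x] cs_sq_add[OF K, of y] cs_sq_add[OF K, of z] sg unfolding S_def by algebra
  then have "(sn K y * sin \<gamma>)\<^sup>2 \<le> (sn K z)\<^sup>2" using K by simp
  then have "sn K y * sin \<gamma> \<le> sn K z" by (rule power2_le_imp_le) (use sz in simp)
  moreover have "sn K x * \<epsilon> / x \<le> \<epsilon> * M" using M x \<epsilon> mult_left_mono[OF M \<epsilon>] by (simp add: field_simps)
  moreover have "0 \<le> sn K y * sin \<gamma>" using y \<gamma> by (simp add: sin_ge_zero)
  moreover have "0 \<le> \<epsilon> * M" using x M \<epsilon> by (smt (verit) mult_nonneg_nonneg zero_less_mult_iff)
  ultimately have "sn K x * \<epsilon> / x * (sn K y * sin \<gamma>) \<le> (\<epsilon> * M) * sn K z" by (intro mult_mono) auto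
  with le have "sn K z * cos c \<le> S + (\<epsilon> * M) * sn K z" by linarith
  then have "cos c \<le> S / sn K z + \<epsilon> * M" using sz by (simp add: field_simps)
  also have "S / sn K z = (cs K y - cs K x * cs K z) / (K * (sn K x * sn K z))"
  proof -
    have "K * sn K x * S = cs K y - cs K x * cs K z"
      unfolding S_def cz using cs_sq_add[OF K, of x] by algebra
    then show ?thesis using K x sz by (simp add: field_simps)
  qed
  finally show ?thesis .
qed


section \<open>Upper angles do not exceed comparison angles\<close>

lemma angleK_commute: "angleK K X V Y = angleK K Y V X"
  by (simp add: angleK_def comp_angle_def Let_def dist_commute mult.commute mult.left_commute add.commute)

text \<open>Hypothesis \<open>min\<close> is minimality in the direction of \<open>\<sigma>\<close>
  alone: shortening that side lowers the angle at \<open>V\<close> by at most the penalty it costs.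
  The number \<open>c\<close> stands for anything above the upper angle at the far end, so the
  conclusion bounds that upper angle from below by its comparison angle, up to the error in the
  cosine.\<close>

lemma penalised_minimum_angle:
  fixes \<sigma> \<tau> :: "real \<Rightarrow> 'a::metric_space"
  assumes K: "K \<noteq> 0" and RK: "RK_domain K TYPE('a)"
    and \<sigma>: "unit_speed \<sigma> x" "0 < x" "\<sigma> 0 = V" and \<tau>: "unit_speed \<tau> y" "0 < y" "\<tau> 0 = V"
    and ne: "\<sigma> x \<noteq> \<tau> y" and \<gamma>: "0 < angleK K (\<sigma> x) V (\<tau> y)" "angleK K (\<sigma> x) V (\<tau> y) < pi"
    and \<epsilon>: "0 \<le> \<epsilon>" and M: "sn K x \<le> x * M"
    and min: "\<And>s. 0 < s \<Longrightarrow> s < x \<Longrightarrow>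
      angleK K (\<sigma> x) V (\<tau> y) + \<epsilon> * ln ((x - s) / x) \<le> angleK K (\<sigma> (x - s)) V (\<tau> y)"
    and \<eta>: "unit_speed \<eta> (dist (\<sigma> x) (\<tau> y))" "\<eta> 0 = \<sigma> x" "\<eta> (dist (\<sigma> x) (\<tau> y)) = \<tau> y"
    and c: "upper_angle (\<sigma> x) ((\<lambda>s. \<sigma> (x - s)) ` {0..x}) (\<eta> ` {0..dist (\<sigma> x) (\<tau> y)}) < ereal c \<or> c = pi"
      "0 \<le> c" "c \<le> pi"
  shows "cos c \<le> cos (angleK K V (\<sigma> x) (\<tau> y)) + \<epsilon> * M"
proof -
  define z where "z = dist (\<sigma> x) (\<tau> y)"
  have z: "0 < z" unfolding z_def using ne by simp
  have r\<sigma>: "unit_speed (\<lambda>s. \<sigma> (x - s)) x" using unit_speed_reverse[OF \<sigma>(1), of x] \<sigma>(2) by simp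
  obtain e \<rho> where e: "0 < e" "e \<le> x" "0 < \<rho>"
    and fv: "\<And>s. 0 < s \<Longrightarrow> s < e \<Longrightarrow> dist (\<sigma> (x - s)) (\<eta> z) \<le> z - s * cos c + s\<^sup>2 / (2 * \<rho>)"
    by (rule first_variation[OF r\<sigma> \<sigma>(2) _ \<eta>(1)[folded z_def] z \<eta>(2) c[folded z_def]]) auto
  have d\<sigma>: "dist V (\<sigma> u) = u" if "0 \<le> u" "u \<le> x" for u
    using unit_speedD[OF \<sigma>(1), of 0 u] \<sigma> that by simp
  have d\<tau>: "dist V (\<tau> y) = y" using unit_speedD[OF \<tau>(1), of 0 y] \<tau> by simp
  have ne': "V \<noteq> \<tau> y" "V \<noteq> \<sigma> u" if "0 < u" "u \<le> x" for u
    using d\<tau> d\<sigma>[of u] \<tau> that by auto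
  have lt: "K > 0 \<Longrightarrow> y < pi / sqrt K" "K > 0 \<Longrightarrow> z < pi / sqrt K" "K > 0 \<Longrightarrow> u < pi / sqrt K"
    if "0 < u" "u \<le> x" for u
    using RK_dist_less[OF RK, of V "\<tau> y"] RK_dist_less[OF RK, of "\<sigma> x" "\<tau> y"] RK_dist_less[OF RK, of V "\<sigma> u"] d\<sigma>[of u] d\<tau> that
    unfolding z_def by auto
  have sny: "0 < sn K y" using lt(1)[of x] \<sigma> \<tau> K by (intro sn_pos) auto
  have cosine: "cs K (dist (\<sigma> u) (\<tau> y)) = cs K u * cs K y + K * (sn K u * sn K y * cos (angleK K (\<sigma> u) V (\<tau> y)))"
    if "0 < u" "u \<le> x" for u
  proof -
    have "0 < sn K u" using lt(3)[OF that] that K by (intro sn_pos) auto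
    then show ?thesis
      using cos_angleK(1)[OF K RK ne'(2)[OF that] ne'(1)[OF that]] sny K d\<sigma>[of u] d\<tau> that by simp
  qed
  have "cos c \<le> (cs K y - cs K x * cs K z) / (K * (sn K x * sn K z)) + \<epsilon> * M"
  proof (rule penalised_first_variation[OF K \<sigma>(2) _ _ sny z _ _ \<gamma> \<epsilon> M e])
    show "0 < sn K x" using lt(3)[of x] \<sigma> K by (intro sn_pos) auto
    show "cs K z = cs K x * cs K y + K * (sn K x * sn K y * cos (angleK K (\<sigma> x) V (\<tau> y)))"
      unfolding z_def using \<sigma> by (intro cosine) auto
    fix s assume s: "0 < s" "s < e"
    show "0 \<le> dist (\<sigma> (x - s)) (\<tau> y) \<and> dist (\<sigma> (x - s)) (\<tau> y) \<le> z - s * cos c + s\<^sup>2 / (2 * \<rho>)"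
      using fv[OF s] \<eta>(3) by (simp add: z_def)
    show "cs K (dist (\<sigma> (x - s)) (\<tau> y)) = cs K (x - s) * cs K y + K * (sn K (x - s) * sn K y * cos (angleK K (\<sigma> (x - s)) V (\<tau> y)))"
      using s e by (intro cosine) auto
    have "angleK K (\<sigma> (x - s)) V (\<tau> y) \<le> pi" using s e by (intro cos_angleK(3)[OF K RK] ne') auto
    then show "angleK K (\<sigma> x) V (\<tau> y) + \<epsilon> * ln ((x - s) / x) \<le> angleK K (\<sigma> (x - s)) V (\<tau> y) \<and>
        angleK K (\<sigma> (x - s)) V (\<tau> y) \<le> pi"
      using min[of s] s e by simp
  qed (use lt[of x] \<sigma> in auto)
  moreover have "cos (angleK K V (\<sigma> x) (\<tau> y)) = (cs K y - cs K x * cs K z) / (K * (sn K x * sn K z))"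
    using cos_angleK(1)[OF K RK ne'(2)[symmetric] ne] d\<sigma>[of x] d\<tau> \<sigma>(2) by (simp add: z_def dist_commute)
  ultimately show ?thesis by simp
qed

text \<open>Angle comparison. Were \<open>\<alpha>\<close> larger than the comparison angle \<open>\<gamma> a b\<close>, one could minimise
  \<open>\<gamma> x y - \<epsilon> ln x - \<epsilon> ln y\<close> over the sides. At a minimum neither side can be shortened with profit,
  so by the first variation both upper angles at the far vertices are at least their comparison
  angles up to a small error, and the angle sum condition forces \<open>\<alpha> \<le> \<gamma> x y \<le> \<gamma> a b\<close> up to that error.\<close>
lemma upper_angle_le_angleK:
  fixes \<sigma> \<tau> :: "real \<Rightarrow> 'a::metric_space"
  assumes K: "K \<noteq> 0" and RK: "RK_domain K TYPE('a)"
    and \<sigma>: "unit_speed \<sigma> a" "0 < a" "\<sigma> 0 = V" and \<tau>: "unit_speed \<tau> b" "0 < b" "\<tau> 0 = V"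
    and \<alpha>: "upper_angle V (\<sigma> ` {0..a}) (\<tau> ` {0..b}) = ereal \<alpha>" "\<alpha> \<le> pi"
  shows "\<alpha> \<le> angleK K (\<sigma> a) V (\<tau> b)"
proof (rule ccontr)
  assume contra: "\<not> ?thesis"
  define \<gamma> where "\<gamma> x y = angleK K (\<sigma> x) V (\<tau> y)" for x y
  \<comment> \<open>Each of the two far vertices costs \<open>2 * \<delta>\<close>: one
    \<open>\<delta>\<close> to get strictly above the upper angle, one to undo the cosine. The fifth
    part keeps the final inequality strict.\<close>
  define \<delta> where "\<delta> = (\<alpha> - \<gamma> a b) / 5"
  have "5 * \<delta> = \<alpha> - \<gamma> a b" by (simp add: \<delta>_def)
  then have \<delta>: "0 < \<delta>" "\<gamma> a b + 4 * \<delta> < \<alpha>" using contra unfolding \<gamma>_def by linarith+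
  have d\<sigma>: "dist V (\<sigma> x) = x" "V \<noteq> \<sigma> x" if "0 < x" "x \<le> a" for x
    using unit_speedD[OF \<sigma>(1), of 0 x] \<sigma> that by auto
  have d\<tau>: "dist V (\<tau> y) = y" "V \<noteq> \<tau> y" if "0 < y" "y \<le> b" for y
    using unit_speedD[OF \<tau>(1), of 0 y] \<tau> that by auto
  have us: "unit_speed \<sigma> x" "unit_speed \<tau> y" if "x \<le> a" "y \<le> b" for x y
    using unit_speed_subset[OF \<sigma>(1)] unit_speed_subset[OF \<tau>(1)] that by auto
  have \<alpha>': "upper_angle V (\<sigma> ` {0..x}) (\<tau> ` {0..y}) = ereal \<alpha>" if "0 < x" "x \<le> a" "0 < y" "y \<le> b" for x y
    using upper_angle_restrict[OF \<sigma> \<tau> that] \<alpha> by simp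
  have \<gamma>_range: "0 \<le> \<gamma> x y" "\<gamma> x y \<le> pi" if "0 < x" "x \<le> a" "0 < y" "y \<le> b" for x y
    unfolding \<gamma>_def by (fact cos_angleK(2,3)[OF K RK d\<sigma>(2)[OF that(1,2)] d\<tau>(2)[OF that(3,4)]])+
  have sn: "0 < sn K x" "0 < sn K y" if "0 < x" "x \<le> a" "0 < y" "y \<le> b" for x y
    using that K RK_dist_less[OF RK, of V "\<sigma> x"] RK_dist_less[OF RK, of V "\<tau> y"] d\<sigma>[of x] d\<tau>[of y]
    by (auto intro!: sn_pos)
  have "0 < \<alpha>" using \<delta> \<gamma>_range[of a b] \<sigma> \<tau> by linarith
  \<comment> \<open>The first variation needs an angle strictly between 0 and pi. Angle 0 means a
    degenerate comparison triangle, which is incompatible with a positive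
    \<open>\<alpha>\<close>.\<close>
  have \<gamma>_pos: "0 < \<gamma> x y" if xy: "0 < x" "x \<le> a" "0 < y" "y \<le> b" for x y
  proof (rule ccontr)
    assume "\<not> ?thesis"
    then have "\<gamma> x y = 0" using \<gamma>_range[OF xy] by simp
    then have "cos (\<gamma> x y) = 1" by simp
    then have "1 = (cs K (dist (\<sigma> x) (\<tau> y)) - cs K x * cs K y) / (K * (sn K x * sn K y))"
      using cos_angleK(1)[OF K RK d\<sigma>(2)[OF xy(1,2)] d\<tau>(2)[OF xy(3,4)]]
      unfolding \<gamma>_def d\<sigma>(1)[OF xy(1,2)] d\<tau>(1)[OF xy(3,4)] by (simp only:)
    moreover have "K * (sn K x * sn K y) \<noteq> 0" using sn[OF xy] K by simp
    ultimately have "K * (sn K x * sn K y) = cs K (dist (\<sigma> x) (\<tau> y)) - cs K x * cs K y"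
      by (metis nonzero_eq_divide_eq mult_1_left)
    then have eq: "cs K (dist (\<sigma> x) (\<tau> y)) = cs K \<bar>x - y\<bar>"
      using cs_diff[OF K, of x y] by (simp add: abs_if flip: cs_minus[of K "x - y"])
    have z: "dist (\<sigma> x) (\<tau> y) = \<bar>x - y\<bar>"
    proof (rule ccontr)
      assume "dist (\<sigma> x) (\<tau> y) \<noteq> \<bar>x - y\<bar>"
      moreover have "\<bar>x - y\<bar> \<le> dist (\<sigma> x) (\<tau> y)"
        using dist_triangle[of V "\<sigma> x" "\<tau> y"] dist_triangle[of V "\<tau> y" "\<sigma> x"] d\<sigma>(1)[OF xy(1,2)] d\<tau>(1)[OF xy(3,4)]
        by (simp add: dist_commute abs_le_iff)
      ultimately have "K * cs K (dist (\<sigma> x) (\<tau> y)) < K * cs K \<bar>x - y\<bar>"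
        using K RK_dist_less[OF RK, of "\<sigma> x" "\<tau> y"] by (intro cs_strict_antimono) (auto simp: below_diam_def)
      then show False using eq by simp
    qed
    show False
    proof (cases "x = y")
      case False
      then have "\<alpha> \<le> 0"
        using upper_angle_degenerate[OF K RK us(1)[OF xy(2,4)] xy(1) \<sigma>(3) us(2)[OF xy(2,4)] xy(3) \<tau>(3) _ \<alpha>'[OF xy] z] z by force
      then show False using \<open>0 < \<alpha>\<close> by simp
    next
      \<comment> \<open>Here the two end points coincide and span no triangle, so the midpoint of
        one side replaces its end.\<close>
      case True
      then have eq: "\<sigma> x = \<tau> y" using z by simp
      have x2: "0 < x / 2" "x / 2 \<le> a" using xy by auto
      have z2: "dist (\<sigma> (x / 2)) (\<tau> y) = \<bar>x / 2 - y\<bar>"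
        using unit_speedD[OF \<sigma>(1), of "x / 2" x] xy True unfolding eq[symmetric] by simp
      then have "\<sigma> (x / 2) \<noteq> \<tau> y" using xy True by auto
      then have "\<alpha> \<le> 0"
        by (rule upper_angle_degenerate[OF K RK us(1)[OF x2(2) xy(4)] x2(1) \<sigma>(3) us(2)[OF xy(2,4)] xy(3) \<tau>(3) _ \<alpha>'[OF x2 xy(3,4)] z2])
      then show False using \<open>0 < \<alpha>\<close> by simp
    qed
  qed
  \<comment> \<open>\<open>arccos\<close> has infinite slope at 1 and -1; its uniform continuity
    turns a cosine error below \<open>d\<close> into an angle error below
    \<open>\<delta>\<close>.\<close>
  obtain d where d: "0 < d" "\<And>u v :: real. u \<in> {-1..1} \<Longrightarrow> v \<in> {-1..1} \<Longrightarrow> dist v u < d \<Longrightarrow> dist (arccos v) (arccos u) < \<delta>"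
    using compact_uniformly_continuous[OF continuous_on_arccos' compact_Icc] \<delta>(1)
    unfolding uniformly_continuous_on_def by meson
  have close: "\<xi> \<le> c + \<delta>" if "cos c \<le> cos \<xi> + r" "r < d" "0 \<le> c" "c \<le> pi" "0 \<le> \<xi>" "\<xi> \<le> pi" for c \<xi> r
  proof (cases "cos c \<le> cos \<xi>")
    case True
    then have "\<xi> \<le> c" using that cos_mono_le_eq[of c \<xi>] by simp
    then show ?thesis using \<delta> by simp
  next
    case False
    then have "dist (arccos (cos \<xi>)) (arccos (cos c)) < \<delta>"
      using that by (intro d(2)) (auto simp: dist_real_def)
    then show ?thesis using that by (simp add: arccos_cos dist_real_def)
  qed
  obtain M where M: "1 \<le> M" "\<And>x. 0 < x \<Longrightarrow> x \<le> max a b \<Longrightarrow> sn K x \<le> x * M"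
  proof -
    have "\<exists>t\<in>{0..max a b}. \<forall>s\<in>{0..max a b}. cs K s \<le> cs K t"
      by (rule continuous_attains_sup[OF compact_Icc]) (use \<sigma>(2) continuous_on_cs[OF K continuous_on_id] in auto)
    then obtain t where t: "\<And>s. s \<in> {0..max a b} \<Longrightarrow> cs K s \<le> cs K t" by blast
    show ?thesis
    proof (rule that[of "cs K t"])
      show "1 \<le> cs K t" using t[of 0] \<sigma>(2) by simp
      fix x assume x: "0 < x" "x \<le> max a b"
      then obtain w where w: "0 < w" "w < x" "sn K x - sn K 0 = (x - 0) * cs K w"
        using MVT2[of 0 x "sn K" "cs K"] has_field_derivative_sn[OF K] by blast
      then show "sn K x \<le> x * cs K t" using t[of w] x by (simp add: mult_left_mono)
    qed
  qed
  define \<epsilon> where "\<epsilon> = d / (2 * M)"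
  have \<epsilon>: "0 < \<epsilon>" "\<epsilon> * M < d" using d M by (auto simp: \<epsilon>_def)
  define F where "F x y = \<gamma> x y - \<epsilon> * ln (x / a) - \<epsilon> * ln (y / b)" for x y
  \<comment> \<open>A side shorter than the fraction \<open>q\<close> of its full length has a
    penalty of at least pi, hence a value of \<open>F\<close> no better than that at (a, b). So the
    minimum over the compact rectangle \<open>S\<close> is a minimum over all positive
    lengths.\<close>
  define q where "q = exp (- (pi / \<epsilon>))"
  have q: "0 < q" "q < 1" using \<epsilon>(1) by (auto simp: q_def)
  have small: "pi \<le> - (\<epsilon> * ln (x / l))" if "0 < x" "0 < l" "x < l * q" for x l
  proof -
    have "x / l < q" using that by (simp add: field_simps)
    then have "ln (x / l) < ln q" using that q by (subst ln_less_cancel_iff) auto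
    then have "ln (x / l) < - (pi / \<epsilon>)" by (simp add: q_def)
    then show ?thesis using \<epsilon>(1) by (simp add: field_simps)
  qed
  have log_nonneg: "0 \<le> - (\<epsilon> * ln (x / l))" if "0 < x" "0 < l" "x \<le> l" for x l
    using that \<epsilon>(1) by (simp add: mult_nonneg_nonpos)
  define S where "S = {a * q..a} \<times> {b * q..b}"
  have S: "(x, y) \<in> S \<Longrightarrow> 0 < x \<and> x \<le> a \<and> 0 < y \<and> y \<le> b" for x y
    using q \<sigma>(2) \<tau>(2) by (auto simp: S_def intro: less_le_trans[OF mult_pos_pos])
  have ab: "(a, b) \<in> S" using q \<sigma>(2) \<tau>(2) by (auto simp: S_def mult_left_le)
  have "continuous_on S (\<lambda>(x, y). F x y)"
  proof -
    have cf: "continuous_on S fst" "continuous_on S snd" by (auto intro!: continuous_intros)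
    have im: "0 < fst p" "fst p \<le> a" "0 < snd p" "snd p \<le> b" if "p \<in> S" for p
      using S[of "fst p" "snd p"] that by simp_all
    have "fst ` S \<subseteq> {0..a}" "snd ` S \<subseteq> {0..b}" by (auto dest: S intro: less_imp_le)
    note c\<sigma> = continuous_on_compose2[OF unit_speed_continuous_on[OF \<sigma>(1)] cf(1) this(1)]
      and c\<tau> = continuous_on_compose2[OF unit_speed_continuous_on[OF \<tau>(1)] cf(2) this(2)]
    let ?q = "\<lambda>p. (cs K (dist (\<sigma> (fst p)) (\<tau> (snd p))) - cs K (fst p) * cs K (snd p)) / (K * (sn K (fst p) * sn K (snd p)))"
    have "continuous_on S ?q"
    proof (intro continuous_on_divide continuous_on_diff continuous_on_mult continuous_on_const
        continuous_on_cs[OF K] continuous_on_sn[OF K] continuous_on_dist c\<sigma> c\<tau> cf ballI)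
      fix p assume "p \<in> S"
      then have "sn K (fst p) \<noteq> 0" "sn K (snd p) \<noteq> 0" using sn[OF im] by (metis less_irrefl)+
      then show "K * (sn K (fst p) * sn K (snd p)) \<noteq> 0" using K by simp
    qed
    moreover have "-1 \<le> ?q p \<and> ?q p \<le> 1" if "p \<in> S" for p
    proof -
      obtain x y where p: "p = (x, y)" by (cases p)
      then have xy: "0 < x" "x \<le> a" "0 < y" "y \<le> b" using S that by auto
      have "\<bar>?q p\<bar> \<le> 1"
        using cos_angleK(4)[OF K RK d\<sigma>(2)[OF xy(1,2)] d\<tau>(2)[OF xy(3,4)]] d\<sigma>(1)[OF xy(1,2)] d\<tau>(1)[OF xy(3,4)]
        by (simp only: p fst_conv snd_conv)
      then show ?thesis by linarith
    qed
    ultimately have "continuous_on S (\<lambda>p. arccos (?q p))" by (intro continuous_on_arccos) auto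
    then have "continuous_on S (\<lambda>p. arccos (?q p) - \<epsilon> * ln (fst p / a) - \<epsilon> * ln (snd p / b))"
    proof (intro continuous_on_diff continuous_on_mult continuous_on_const continuous_on_ln
        continuous_on_divide cf ballI)
      fix p assume "p \<in> S"
      then show "fst p / a \<noteq> 0" "snd p / b \<noteq> 0" using im[of p] \<sigma>(2) \<tau>(2) by simp_all
    qed (use \<sigma>(2) \<tau>(2) in auto)
    moreover have "arccos (?q p) - \<epsilon> * ln (fst p / a) - \<epsilon> * ln (snd p / b) = (case p of (x, y) \<Rightarrow> F x y)" if "p \<in> S" for p
      using d\<sigma>(1)[OF im(1,2)[OF that]] d\<tau>(1)[OF im(3,4)[OF that]]
      by (simp add: F_def \<gamma>_def angleK_def comp_angle_eq[OF K] case_prod_beta)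
    ultimately show ?thesis by (simp cong: continuous_on_cong)
  qed
  moreover have "compact S" unfolding S_def by (intro compact_Times compact_Icc)
  ultimately obtain x y where xy_S: "(x, y) \<in> S" and minS: "\<And>x' y'. (x', y') \<in> S \<Longrightarrow> F x y \<le> F x' y'"
    using continuous_attains_inf[of S "\<lambda>(x, y). F x y"] ab by fastforce
  have xy: "0 < x" "x \<le> a" "0 < y" "y \<le> b" using S[OF xy_S] by auto
  have Fab: "F a b = \<gamma> a b" using \<sigma>(2) \<tau>(2) by (simp add: F_def)
  have min: "F x y \<le> F x' y'" if "0 < x'" "x' \<le> a" "0 < y'" "y' \<le> b" for x' y'
  proof (cases "(x', y') \<in> S")
    case False
    then have "x' < a * q \<or> y' < b * q" using that by (auto simp: S_def)
    then have "pi \<le> - (\<epsilon> * ln (x' / a)) + - (\<epsilon> * ln (y' / b))"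
      using small[of x' a] small[of y' b] log_nonneg[of x' a] log_nonneg[of y' b] that \<sigma>(2) \<tau>(2) by force
    then have "pi \<le> F x' y'" using \<gamma>_range[OF that] by (simp add: F_def)
    moreover have "F x y \<le> pi" using minS[OF ab] Fab \<gamma>_range[of a b] \<sigma>(2) \<tau>(2) by linarith
    ultimately show ?thesis by simp
  qed (rule minS)
  have "\<gamma> x y \<le> F x y"
    using log_nonneg[of x a] log_nonneg[of y b] xy \<sigma>(2) \<tau>(2) by (simp add: F_def)
  then have \<gamma>_le: "\<gamma> x y \<le> \<gamma> a b" using minS[OF ab] Fab by simp
  then have \<gamma>_pi: "\<gamma> x y < pi" using \<delta> \<alpha>(2) by linarith
  have ne: "\<sigma> x \<noteq> \<tau> y"
  proof
    assume "\<sigma> x = \<tau> y"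
    then have "y = x" "dist (\<sigma> x) (\<tau> y) = x - y" using d\<sigma>(1)[OF xy(1,2)] d\<tau>(1)[OF xy(3,4)] by simp_all
    then have "\<gamma> x y = 0"
      using comp_angle_degenerate(2)[OF K sn[OF xy]] d\<sigma>(1)[OF xy(1,2)] d\<tau>(1)[OF xy(3,4)] by (simp add: \<gamma>_def angleK_def)
    then show False using \<gamma>_pos[OF xy] by simp
  qed
  note \<sigma>x = us(1)[OF xy(2,4)] xy(1) \<sigma>(3) and \<tau>y = us(2)[OF xy(2,4)] xy(3) \<tau>(3)
  define z where "z = dist (\<sigma> x) (\<tau> y)"
  obtain \<eta> \<phi> \<psi> where \<eta>: "unit_speed \<eta> z" "\<eta> 0 = \<sigma> x" "\<eta> z = \<tau> y"
    and \<phi>: "upper_angle (\<sigma> x) ((\<lambda>s. \<sigma> (x - s)) ` {0..x}) (\<eta> ` {0..z}) = ereal \<phi>" "0 \<le> \<phi>"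
    and \<psi>: "upper_angle (\<tau> y) ((\<lambda>s. \<tau> (y - s)) ` {0..y}) ((\<lambda>s. \<eta> (z - s)) ` {0..z}) = ereal \<psi>" "0 \<le> \<psi>"
    and sum: "\<alpha> + \<phi> + \<psi> \<le> \<gamma> x y + angleK K V (\<sigma> x) (\<tau> y) + angleK K V (\<tau> y) (\<sigma> x)"
    by (rule RK_angle_sum[OF RK \<sigma>x \<tau>y ne \<alpha>'[OF xy], folded z_def \<gamma>_def])
  have log_diff: "ln (u / l) = ln (x' / l) + ln (u / x')" if "0 < u" "0 < x'" "0 < l" for u x' l :: real
    using that by (simp add: ln_div)
  \<comment> \<open>Truncation at pi keeps the bound in the range of angles; when it takes effect,
    the case \<open>c = pi\<close> of the first variation applies.\<close>
  have "cos (min pi (\<phi> + \<delta>)) \<le> cos (angleK K V (\<sigma> x) (\<tau> y)) + \<epsilon> * M"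
  proof (rule penalised_minimum_angle[OF K RK \<sigma>x \<tau>y ne, folded z_def \<gamma>_def, OF \<gamma>_pos[OF xy] \<gamma>_pi])
    show "\<gamma> x y + \<epsilon> * ln ((x - s) / x) \<le> \<gamma> (x - s) y" if "0 < s" "s < x" for s
      using min[of "x - s" y] log_diff[of "x - s" x a] that xy by (simp add: F_def algebra_simps)
    show "upper_angle (\<sigma> x) ((\<lambda>s. \<sigma> (x - s)) ` {0..x}) (\<eta> ` {0..z}) < ereal (min pi (\<phi> + \<delta>)) \<or> min pi (\<phi> + \<delta>) = pi"
      using \<phi> \<delta> by (auto simp: min_def)
  qed (use \<epsilon> M xy \<eta> \<phi> \<delta> in auto)
  then have "angleK K V (\<sigma> x) (\<tau> y) \<le> min pi (\<phi> + \<delta>) + \<delta>"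
    using \<phi> \<delta> \<epsilon> by (intro close[where r = "\<epsilon> * M"] cos_angleK[OF K RK] d\<sigma>(2)[OF xy(1,2), symmetric] ne) auto
  then have \<xi>: "angleK K V (\<sigma> x) (\<tau> y) \<le> \<phi> + 2 * \<delta>" by linarith
  have "cos (min pi (\<psi> + \<delta>)) \<le> cos (angleK K V (\<tau> y) (\<sigma> x)) + \<epsilon> * M"
  proof (rule penalised_minimum_angle[OF K RK \<tau>y \<sigma>x ne[symmetric], unfolded dist_commute[of "\<tau> y" "\<sigma> x"] angleK_commute[of K "\<tau> _" V], folded z_def \<gamma>_def, OF \<gamma>_pos[OF xy] \<gamma>_pi])
    show "\<gamma> x y + \<epsilon> * ln ((y - s) / y) \<le> \<gamma> x (y - s)" if "0 < s" "s < y" for s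
      using min[of x "y - s"] log_diff[of "y - s" y b] that xy by (simp add: F_def algebra_simps)
    show "upper_angle (\<tau> y) ((\<lambda>s. \<tau> (y - s)) ` {0..y}) ((\<lambda>s. \<eta> (z - s)) ` {0..z}) < ereal (min pi (\<psi> + \<delta>)) \<or> min pi (\<psi> + \<delta>) = pi"
      using \<psi> \<delta> by (auto simp: min_def)
    show "unit_speed (\<lambda>s. \<eta> (z - s)) z" using unit_speed_reverse[OF \<eta>(1), of z] by (simp add: z_def)
  qed (use \<epsilon> M xy \<eta> \<psi> \<delta> in auto)
  then have "angleK K V (\<tau> y) (\<sigma> x) \<le> min pi (\<psi> + \<delta>) + \<delta>"
    using \<psi> \<delta> \<epsilon> by (intro close[where r = "\<epsilon> * M"] cos_angleK[OF K RK] d\<tau>(2)[OF xy(3,4), symmetric] ne[symmetric]) auto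
  then have "angleK K V (\<tau> y) (\<sigma> x) \<le> \<psi> + 2 * \<delta>" by linarith
  with \<xi> sum \<gamma>_le \<delta> show False by linarith
qed

text \<open>In the model space equality holds, because the point at distance \<open>t\<close> from
  \<open>A\<close> is (sn (l - t) A + sn t B) / sn l as a vector. It is essential that one
  \<open>X\<close> serves all \<open>P\<close>, as it will be compared with both ends of a diagonal.
  The upper angles at \<open>X\<close> towards \<open>A\<close> and \<open>B\<close> add up to at
  least pi, hence so do the comparison angles, and their cosines have a nonpositive sum.\<close>

lemma dist_to_side:
  fixes A B :: "'a::metric_space"
  assumes K: "K \<noteq> 0" and RK: "RK_domain K TYPE('a)" and t: "0 \<le> t" "t \<le> dist A B"
  obtains X where "\<And>P. K * (sn K (dist A B - t) * cs K (dist A P) + sn K t * cs K (dist B P)) \<le> K * (sn K (dist A B) * cs K (dist X P))"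
proof -
  define l where "l = dist A B"
  obtain L where L: "shortest A B L" by (rule RK_shortest[OF RK])
  obtain \<beta> where \<beta>: "unit_speed \<beta> l" "\<beta> 0 = A" "\<beta> l = B"
    by (rule shortest_unit_speed[OF L, folded l_def])
  have tl: "t \<le> l" using t by (simp add: l_def)
  define X where "X = \<beta> t"
  have XA: "dist A X = t" and XB: "dist B X = l - t"
    using unit_speedD[OF \<beta>(1), of 0 t] unit_speedD[OF \<beta>(1), of l t] t tl \<beta> by (auto simp: X_def)
  have "K * (sn K (l - t) * cs K (dist A P) + sn K t * cs K (dist B P)) \<le> K * (sn K l * cs K (dist X P))" for P
  proof -
    consider "t = 0" | "t = l" | "P = X" | "0 < t" "t < l" "P \<noteq> X" using t tl by linarith
    then show ?thesis
    proof cases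
      case 1
      then show ?thesis using XA by simp
    next
      case 2
      then show ?thesis using XB by simp
    next
      case 3
      have "sn K (l - t) * cs K t + sn K t * cs K (l - t) = sn K l"
        using sn_add[of K "l - t" t] by (simp add: mult.commute)
      then show ?thesis unfolding 3 XA XB by simp
    next
      case 4
      define h where "h = dist X P"
      have h: "0 < h" using 4 by (simp add: h_def)
      obtain N where N: "shortest X P N" by (rule RK_shortest[OF RK])
      obtain \<sigma> where \<sigma>: "unit_speed \<sigma> h" "\<sigma> 0 = X" "\<sigma> h = P"
        by (rule shortest_unit_speed[OF N, folded h_def])
      define \<tau> \<upsilon> where "\<tau> s = \<beta> (t - s)" and "\<upsilon> s = \<beta> (t + s)" for s
      have \<tau>: "unit_speed \<tau> t" "0 < t" "\<tau> 0 = X" and \<upsilon>: "unit_speed \<upsilon> (l - t)" "0 < l - t" "\<upsilon> 0 = X"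
        using unit_speed_reverse[OF \<beta>(1), of t] unit_speed_shift[OF \<beta>(1), of t "l - t"] 4
        by (auto simp: \<tau>_def[abs_def] \<upsilon>_def[abs_def] X_def)
      have endpts: "\<tau> t = A" "\<upsilon> (l - t) = B" by (auto simp: \<tau>_def \<upsilon>_def \<beta>)
      note \<sigma>' = \<sigma>(1) h \<sigma>(2)
      obtain \<phi>\<^sub>1 where \<phi>1: "upper_angle X (\<sigma> ` {0..h}) (\<tau> ` {0..t}) = ereal \<phi>\<^sub>1" "0 \<le> \<phi>\<^sub>1" "\<phi>\<^sub>1 \<le> pi"
        by (rule upper_angle_real[OF \<sigma>' \<tau>])
      obtain \<phi>\<^sub>2 where \<phi>2: "upper_angle X (\<sigma> ` {0..h}) (\<upsilon> ` {0..l - t}) = ereal \<phi>\<^sub>2" "0 \<le> \<phi>\<^sub>2" "\<phi>\<^sub>2 \<le> pi"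
        by (rule upper_angle_real[OF \<sigma>' \<upsilon>])
      have "pi \<le> \<phi>\<^sub>1 + \<phi>\<^sub>2"
        by (rule adjacent_upper_angles[OF \<sigma>' \<tau> \<upsilon> _ \<phi>1(1,2) \<phi>2(1,2)]) (simp add: endpts flip: l_def)
      moreover have "\<phi>\<^sub>1 \<le> angleK K P X A" "\<phi>\<^sub>2 \<le> angleK K P X B"
        using upper_angle_le_angleK[OF K RK \<sigma>' \<tau> \<phi>1(1,3)] upper_angle_le_angleK[OF K RK \<sigma>' \<upsilon> \<phi>2(1,3)]
        by (simp_all add: \<sigma> endpts)
      ultimately have sum: "pi \<le> angleK K P X A + angleK K P X B" by linarith
      have ne: "X \<noteq> P" "X \<noteq> A" "X \<noteq> B" using 4 XA XB by auto
      note cA = cos_angleK[OF K RK ne(1,2)] and cB = cos_angleK[OF K RK ne(1,3)]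
      have "cos (angleK K P X A) \<le> cos (pi - angleK K P X B)"
        using sum cA cB by (intro cos_monotone_0_pi_le) auto
      then have "cos (angleK K P X A) + cos (angleK K P X B) \<le> 0" by simp
      moreover have d: "dist P A = dist A P" "dist P B = dist B P" "dist X A = t" "dist X B = l - t" "dist X P = h"
        using XA XB by (simp_all add: dist_commute h_def)
      ultimately have le: "(cs K (dist A P) - cs K h * cs K t) / (K * (sn K h * sn K t)) +
          (cs K (dist B P) - cs K h * cs K (l - t)) / (K * (sn K h * sn K (l - t))) \<le> 0"
        using cA(1) cB(1) by simp
      have sn: "0 < sn K h" "0 < sn K t" "0 < sn K (l - t)"
        using K h 4 RK_dist_less[OF RK, of X P] RK_dist_less[OF RK, of A X] RK_dist_less[OF RK, of B X]
        unfolding XA XB h_def[symmetric] by (auto intro!: sn_pos)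
      define p where "p = sn K h * sn K t * sn K (l - t)"
      have p: "0 < p" using sn by (simp add: p_def)
      \<comment> \<open>The factor \<open>K * K * p\<close> clears both denominators and is
        nonnegative for either sign of \<open>K\<close>.\<close>
      have e: "(K * K * p) * ((cs K (dist A P) - cs K h * cs K t) / (K * (sn K h * sn K t)) +
          (cs K (dist B P) - cs K h * cs K (l - t)) / (K * (sn K h * sn K (l - t)))) =
          K * (sn K (l - t) * (cs K (dist A P) - cs K h * cs K t) + sn K t * (cs K (dist B P) - cs K h * cs K (l - t)))"
        using sn K by (simp add: p_def field_simps)
      have "0 \<le> K * K * p" using p by (intro mult_nonneg_nonneg[OF zero_le_square]) simp
      then have "K * (sn K (l - t) * (cs K (dist A P) - cs K h * cs K t) + sn K t * (cs K (dist B P) - cs K h * cs K (l - t))) \<le> 0"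
        using mult_nonneg_nonpos[OF _ le] unfolding e[symmetric] by blast
      also have "sn K (l - t) * (cs K (dist A P) - cs K h * cs K t) + sn K t * (cs K (dist B P) - cs K h * cs K (l - t)) =
          sn K (l - t) * cs K (dist A P) + sn K t * cs K (dist B P) - sn K l * cs K h"
        using sn_add[of K "l - t" t] by (simp add: algebra_simps)
      finally show ?thesis unfolding d by (simp add: right_diff_distrib)
    qed
  qed
  then show ?thesis using that unfolding l_def by blast
qed

section \<open>Quadrilaterals in the model space\<close>

text \<open>For angles \<open>\<alpha>, \<beta>\<close> in \<open>[0, \<pi>]\<close>: if \<open>cos \<alpha> + cos \<beta> > 0\<close>, then \<open>\<alpha> + \<beta> < \<pi>\<close> and so
  \<open>sin (\<alpha> + \<beta>) > 0\<close> unless both vanish.\<close>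
lemma cross_pos:
  fixes p q :: real
  assumes "0 \<le> p" "0 \<le> q" "0 \<le> p\<^sub>2" "0 \<le> q\<^sub>2"
    and p: "p\<^sup>2 = p\<^sub>1\<^sup>2 + p\<^sub>2\<^sup>2" and q: "q\<^sup>2 = q\<^sub>1\<^sup>2 + q\<^sub>2\<^sup>2" and pos: "0 < p\<^sub>1 * q + q\<^sub>1 * p"
    and "0 < p\<^sub>2 + q\<^sub>2"
  shows "0 < p\<^sub>1 * q\<^sub>2 + q\<^sub>1 * p\<^sub>2"
proof -
  have *: "0 < p\<^sub>1 * q\<^sub>2 + q\<^sub>1 * p\<^sub>2"
    if "0 \<le> p" "0 \<le> q" "0 \<le> p\<^sub>2" "0 \<le> q\<^sub>2" "p\<^sup>2 = p\<^sub>1\<^sup>2 + p\<^sub>2\<^sup>2" "q\<^sup>2 = q\<^sub>1\<^sup>2 + q\<^sub>2\<^sup>2"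
      "0 < p\<^sub>1 * q + q\<^sub>1 * p" "q\<^sub>1 < 0" for p q p\<^sub>1 p\<^sub>2 q\<^sub>1 q\<^sub>2 :: real
  proof -
    have le: "- q\<^sub>1 * p < p\<^sub>1 * q" using that by simp
    have "0 \<le> - q\<^sub>1 * p" using that by (simp add: mult_nonpos_nonneg)
    with le have "0 < p\<^sub>1 * q" by linarith
    with that have "0 < p\<^sub>1" by (simp add: zero_less_mult_iff)
    have "(- q\<^sub>1 * p)\<^sup>2 < (p\<^sub>1 * q)\<^sup>2" using le \<open>0 \<le> - q\<^sub>1 * p\<close> by (intro power_strict_mono) auto
    moreover have "(- q\<^sub>1 * p\<^sub>2)\<^sup>2 - (p\<^sub>1 * q\<^sub>2)\<^sup>2 = (- q\<^sub>1 * p)\<^sup>2 - (p\<^sub>1 * q)\<^sup>2"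
      using that(5,6) by algebra
    ultimately have "(- q\<^sub>1 * p\<^sub>2)\<^sup>2 < (p\<^sub>1 * q\<^sub>2)\<^sup>2" by linarith
    then have "- q\<^sub>1 * p\<^sub>2 < p\<^sub>1 * q\<^sub>2"
      by (rule power_less_imp_less_base) (use \<open>0 < p\<^sub>1\<close> that in simp)
    then show ?thesis by simp
  qed
  have **: "0 < p\<^sub>1 * q\<^sub>2 + q\<^sub>1 * p\<^sub>2"
    if "0 \<le> p" "0 \<le> q" "0 \<le> p\<^sub>2" "0 \<le> q\<^sub>2" "p\<^sup>2 = p\<^sub>1\<^sup>2 + p\<^sub>2\<^sup>2" "q\<^sup>2 = q\<^sub>1\<^sup>2 + q\<^sub>2\<^sup>2"
      "0 < p\<^sub>1 * q + q\<^sub>1 * p" "0 < p\<^sub>1" "0 \<le> q\<^sub>1" "0 < p\<^sub>2 + q\<^sub>2" for p q p\<^sub>1 p\<^sub>2 q\<^sub>1 q\<^sub>2 :: real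
  proof (cases "q\<^sub>2 = 0")
    case True
    then have "q = q\<^sub>1" using that by simp
    then have "q\<^sub>1 \<noteq> 0" using that by auto
    then show ?thesis using True that by simp
  next
    case False
    then show ?thesis using that by (intro add_pos_nonneg) auto
  qed
  consider "0 < p\<^sub>1 \<and> 0 \<le> q\<^sub>1" | "0 < q\<^sub>1 \<and> 0 \<le> p\<^sub>1" | "p\<^sub>1 = 0 \<and> q\<^sub>1 = 0" | "q\<^sub>1 < 0" | "p\<^sub>1 < 0" by linarith
  then show ?thesis
  proof cases
    case 1
    show ?thesis by (rule **[OF assms(1-7)]) (use 1 assms(8) in auto)
  next
    case 2
    have "0 < q\<^sub>1 * p\<^sub>2 + p\<^sub>1 * q\<^sub>2"
      by (rule **[OF assms(2,1,4,3,6,5)]) (use 2 pos assms(8) in \<open>simp_all only: add.commute\<close>)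
    then show ?thesis by (simp only: add.commute)
  next
    case 3
    then show ?thesis using pos by simp
  next
    case 4
    show ?thesis by (rule *[OF assms(1-7) 4])
  next
    case 5
    have "0 < q\<^sub>1 * p\<^sub>2 + p\<^sub>1 * q\<^sub>2"
      by (rule *[OF assms(2,1,4,3,6,5) _ 5]) (use pos in \<open>simp only: add.commute\<close>)
    then show ?thesis by (simp only: add.commute)
  qed
qed

lemma cauchy_schwarz_2:
  fixes p q :: real
  assumes "0 \<le> p" "0 \<le> q" "p\<^sup>2 = p\<^sub>1\<^sup>2 + p\<^sub>2\<^sup>2" "q\<^sup>2 = q\<^sub>1\<^sup>2 + q\<^sub>2\<^sup>2"
  shows "p\<^sub>1 * q\<^sub>1 + p\<^sub>2 * q\<^sub>2 \<le> p * q"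
proof (rule power2_le_imp_le)
  have "(p * q)\<^sup>2 - (p\<^sub>1 * q\<^sub>1 + p\<^sub>2 * q\<^sub>2)\<^sup>2 = (p\<^sub>1 * q\<^sub>2 - p\<^sub>2 * q\<^sub>1)\<^sup>2"
    unfolding power_mult_distrib assms by (simp add: power2_eq_square algebra_simps)
  then show "(p\<^sub>1 * q\<^sub>1 + p\<^sub>2 * q\<^sub>2)\<^sup>2 \<le> (p * q)\<^sup>2"
    by (metis diff_ge_0_iff_ge zero_le_power2)
qed (use assms in auto)

text \<open>A nonzero vector l A + m B with nonnegative weights is a positive multiple of a point of
  the segment AB; the ratio of the weights determines the point.\<close>

lemma cone_param:
  assumes K: "K \<noteq> 0" and a: "0 < a" "K > 0 \<Longrightarrow> a < pi / sqrt K"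
    and l: "0 \<le> l" "0 \<le> m" "0 < l + m"
  obtains t k where "0 \<le> t" "t \<le> a" "0 < k" "l = k * sn K (a - t)" "m = k * sn K t"
proof -
  have sa: "0 < sn K a" using assms by (intro sn_pos) auto
  have nonneg: "0 \<le> sn K s" if "0 \<le> s" "s \<le> a" for s
    using that a K by (intro sn_nonneg) (auto simp: below_diam_def)
  have pos: "0 < sn K s" if "0 < s" "s \<le> a" for s
    using that a K by (intro sn_pos) auto
  obtain t where t: "0 \<le> t" "t \<le> a" "l * sn K t - m * sn K (a - t) = 0"
  proof (rule IVT'[of "\<lambda>t. l * sn K t - m * sn K (a - t)" 0 0 a, THEN exE])
    show "continuous_on {0..a} (\<lambda>t. l * sn K t - m * sn K (a - t))"
      by (intro continuous_intros K)
  qed (use a sa l that in \<open>auto intro!: mult_nonneg_nonneg\<close>)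
  show ?thesis
  proof (cases "t = 0")
    case True
    then have "m = 0" using t sa by simp
    then show ?thesis using True l sa a by (intro that[of 0 "l / sn K a"]) auto
  next
    case False
    then have st: "0 < sn K t" using t by (intro pos) auto
    have "m \<noteq> 0"
    proof
      assume "m = 0"
      then have "l = 0" using t st by simp
      then show False using l \<open>m = 0\<close> by simp
    qed
    then show ?thesis using t st l
      by (intro that[of t "m / sn K t"]) (auto simp: field_simps)
  qed
qed

lemma below_diam_half:
  assumes "K \<noteq> 0" "K > 0" "0 \<le> p" "p < pi / sqrt K" "0 \<le> cs K p"
  shows "p \<le> pi / sqrt K / 2"
proof (rule ccontr)
  assume "\<not> ?thesis"
  then have "K * cs K p < K * cs K (pi / sqrt K / 2)"
    using assms by (intro cs_strict_antimono) (auto simp: below_diam_def)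
  moreover have "cs K (pi / sqrt K / 2) = 0" using assms by (simp add: cs_def)
  ultimately have "K * cs K p < 0" by simp
  then show False using assms by (simp add: mult_less_0_iff)
qed

lemma cs_ge_one: "K < 0 \<Longrightarrow> 1 \<le> cs K t"
  by (simp add: cs_def cosh_real_ge_1)

text \<open>The numbers \<open>g, h\<close> are the weights of a point \<open>O\<close> with \<open>\<rho> O = g P + h Q\<close> in the
  model space, where \<open>P\<close> and \<open>Q\<close> have inner product \<open>c\<close>; the real points are closer to the
  real \<open>O\<close> than the model points are.\<close>
lemma cs_dist_via_point:
  assumes K: "K \<noteq> 0" and g: "0 \<le> g" "0 \<le> h" and \<rho>: "0 < \<rho>" "\<rho>\<^sup>2 = g\<^sup>2 + h\<^sup>2 + 2 * g * h * c"
    and p: "0 \<le> p" "K > 0 \<Longrightarrow> p < pi / sqrt K" "K * (g + h * c) \<le> K * (\<rho> * cs K p)"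
    and q: "0 \<le> q" "K > 0 \<Longrightarrow> q < pi / sqrt K" "K * (g * c + h) \<le> K * (\<rho> * cs K q)"
    and b: "0 \<le> b" "b \<le> p + q"
    and pos: "K > 0 \<Longrightarrow> 0 \<le> g + h * c \<and> 0 \<le> g * c + h"
    and c: "0 \<le> K * (1 - c\<^sup>2)"
  shows "K * c \<le> K * cs K b"
proof -
  \<comment> \<open>With p' and q' the model distances from O to P and Q, the number
    \<open>g + h * c\<close> is rho cs p' and \<open>g * c + h\<close> is rho cs q'. The right sides
    here are K rho^2 times the squares of sn p' and sn q', and \<open>main\<close> says that cs (p'
    + q') is \<open>c\<close>.\<close>
  have sp: "\<rho>\<^sup>2 - (g + h * c)\<^sup>2 = h\<^sup>2 * (1 - c\<^sup>2)" and sq: "\<rho>\<^sup>2 - (g * c + h)\<^sup>2 = g\<^sup>2 * (1 - c\<^sup>2)"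
    unfolding \<rho>(2) by (simp_all add: power2_eq_square algebra_simps)
  have main: "(g + h * c) * (g * c + h) - g * h * (1 - c\<^sup>2) = \<rho>\<^sup>2 * c"
    unfolding \<rho>(2) by (simp add: power2_eq_square algebra_simps)
  have split: "\<rho>\<^sup>2 * cs K (p + q) = (\<rho> * cs K p) * (\<rho> * cs K q) - K * (\<rho> * sn K p) * (\<rho> * sn K q)"
    using K by (simp add: cs_add power2_eq_square algebra_simps)
  have snp: "K * (\<rho> * sn K p)\<^sup>2 = \<rho>\<^sup>2 - (\<rho> * cs K p)\<^sup>2"
    and snq: "K * (\<rho> * sn K q)\<^sup>2 = \<rho>\<^sup>2 - (\<rho> * cs K q)\<^sup>2"
    using cs_sq_add[OF K, of p] cs_sq_add[OF K, of q] by (simp_all add: power_mult_distrib) algebra+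
  have s0: "0 \<le> \<rho> * sn K p" "0 \<le> \<rho> * sn K q"
    using p q K \<rho> by (auto intro!: mult_nonneg_nonneg sn_nonneg simp: below_diam_def intro: less_imp_le)
  show ?thesis
  proof (cases "K > 0")
    case True
    have gp: "g + h * c \<le> \<rho> * cs K p" "0 \<le> g + h * c" and gq: "g * c + h \<le> \<rho> * cs K q" "0 \<le> g * c + h"
      using p q pos True by auto
    have c1: "0 \<le> 1 - c\<^sup>2" using c True by (simp add: zero_le_mult_iff)
    have "(g + h * c)\<^sup>2 \<le> (\<rho> * cs K p)\<^sup>2" "(g * c + h)\<^sup>2 \<le> (\<rho> * cs K q)\<^sup>2"
      using gp gq by (auto intro!: power_mono)
    then have P: "K * (\<rho> * sn K p)\<^sup>2 \<le> h\<^sup>2 * (1 - c\<^sup>2)" and Q: "K * (\<rho> * sn K q)\<^sup>2 \<le> g\<^sup>2 * (1 - c\<^sup>2)"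
      using snp snq sp sq by auto
    have "(K * (\<rho> * sn K p) * (\<rho> * sn K q))\<^sup>2 = (K * (\<rho> * sn K p)\<^sup>2) * (K * (\<rho> * sn K q)\<^sup>2)"
      by (simp add: power2_eq_square)
    also have "\<dots> \<le> (h\<^sup>2 * (1 - c\<^sup>2)) * (g\<^sup>2 * (1 - c\<^sup>2))"
      using True c1 by (intro mult_mono[OF P Q]) auto
    also have "\<dots> = (g * h * (1 - c\<^sup>2))\<^sup>2" by (simp add: power2_eq_square)
    finally have "K * (\<rho> * sn K p) * (\<rho> * sn K q) \<le> g * h * (1 - c\<^sup>2)"
      by (rule power2_le_imp_le) (intro mult_nonneg_nonneg g c1)
    moreover have "(g + h * c) * (g * c + h) \<le> (\<rho> * cs K p) * (\<rho> * cs K q)"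
      using gp gq by (intro mult_mono) auto
    ultimately have "\<rho>\<^sup>2 * c \<le> \<rho>\<^sup>2 * cs K (p + q)" unfolding split main[symmetric] by linarith
    then have "c \<le> cs K (p + q)" using \<rho>(1) by simp
    \<comment> \<open>Both distances are at most a quarter circle, so monotonicity still applies at
      their sum.\<close>
    moreover have "0 \<le> cs K p" "0 \<le> cs K q"
      using gp gq \<rho> by (metis dual_order.trans zero_le_mult_iff not_le)+
    then have "p \<le> pi / sqrt K / 2" "q \<le> pi / sqrt K / 2"
      using below_diam_half[of K] True p q by auto
    then have "K * cs K (p + q) \<le> K * cs K b"
      using b K by (intro cs_antimono) (auto simp: below_diam_def)
    ultimately show ?thesis using True by (smt (verit) mult_left_mono)
  next
    case False
    then have K0: "K < 0" using K by simp
    have gp: "\<rho> * cs K p \<le> g + h * c" and gq: "\<rho> * cs K q \<le> g * c + h"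
      using p q K0 by auto
    have cp: "0 \<le> \<rho> * cs K p" "0 \<le> \<rho> * cs K q"
      using cs_ge_one[OF K0, of p] cs_ge_one[OF K0, of q] \<rho> by (auto intro!: mult_nonneg_nonneg)
    have c1: "0 \<le> c\<^sup>2 - 1" using c K0 by (simp add: zero_le_mult_iff)
    have "(\<rho> * cs K p)\<^sup>2 \<le> (g + h * c)\<^sup>2" "(\<rho> * cs K q)\<^sup>2 \<le> (g * c + h)\<^sup>2"
      using gp gq cp by (auto intro!: power_mono)
    then have P: "- K * (\<rho> * sn K p)\<^sup>2 \<le> h\<^sup>2 * (c\<^sup>2 - 1)" and Q: "- K * (\<rho> * sn K q)\<^sup>2 \<le> g\<^sup>2 * (c\<^sup>2 - 1)"
      using snp snq sp sq by (auto simp: right_diff_distrib)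
    have "(- K * (\<rho> * sn K p) * (\<rho> * sn K q))\<^sup>2 = (- K * (\<rho> * sn K p)\<^sup>2) * (- K * (\<rho> * sn K q)\<^sup>2)"
      by (simp add: power2_eq_square)
    also have "\<dots> \<le> (h\<^sup>2 * (c\<^sup>2 - 1)) * (g\<^sup>2 * (c\<^sup>2 - 1))"
      using K0 c1 by (intro mult_mono[OF P Q]) (auto simp: mult_nonpos_nonneg)
    also have "\<dots> = (g * h * (c\<^sup>2 - 1))\<^sup>2" by (simp add: power2_eq_square)
    finally have "- K * (\<rho> * sn K p) * (\<rho> * sn K q) \<le> g * h * (c\<^sup>2 - 1)"
      by (rule power2_le_imp_le) (intro mult_nonneg_nonneg g c1)
    moreover have "(\<rho> * cs K p) * (\<rho> * cs K q) \<le> (g + h * c) * (g * c + h)"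
      using gp gq cp by (intro mult_mono) auto
    ultimately have "\<rho>\<^sup>2 * cs K (p + q) \<le> \<rho>\<^sup>2 * c" unfolding split main[symmetric]
      by (simp add: right_diff_distrib)
    then have "cs K (p + q) \<le> c" using \<rho>(1) by simp
    then have "K * c \<le> K * cs K (p + q)" using K0 by simp
    also have "\<dots> \<le> K * cs K b"
      using b K K0 by (intro cs_antimono) (auto simp: below_diam_def)
    finally show ?thesis .
  qed
qed


text \<open>This is \<open>sn x\<close> times the cosine of the angle between the sides \<open>a\<close> and \<open>x\<close> in the model
  triangle with third side \<open>d\<close>.\<close>
definition proj :: "real \<Rightarrow> real \<Rightarrow> real \<Rightarrow> real \<Rightarrow> real" where
  "proj K a x d = (cs K d - cs K x * cs K a) / (K * sn K a)"

section \<open>Coordinates along a side, and quadrilaterals in these coordinates\<close>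

lemma cs_eq_proj: "K \<noteq> 0 \<Longrightarrow> sn K a \<noteq> 0 \<Longrightarrow> cs K d = cs K x * cs K a + K * (sn K a * proj K a x d)"
  by (simp add: proj_def field_simps)

text \<open>A rotation in the plane spanned by the ends of side \<open>a\<close> takes the
  coordinates based at one end to those based at the other.\<close>

lemma proj_swap:
  assumes K: "K \<noteq> 0" and a: "sn K a \<noteq> 0"
  shows "proj K a d x = sn K a * cs K x - cs K a * proj K a x d"
proof -
  have "K * sn K a * proj K a d x = K * sn K a * (sn K a * cs K x - cs K a * proj K a x d)"
    using cs_eq_proj[OF K a, of d x] cs_eq_proj[OF K a, of x d] cs_sq_add[OF K, of a] by algebra
  then show ?thesis using K a by simp
qed

text \<open>Both sides are the squared height of the triangle over \<open>a\<close>, which does not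
  depend on the end of \<open>a\<close> from which it is computed.\<close>

lemma proj_height:
  assumes K: "K \<noteq> 0" and a: "sn K a \<noteq> 0"
  shows "(sn K d)\<^sup>2 - (proj K a d x)\<^sup>2 = (sn K x)\<^sup>2 - (proj K a x d)\<^sup>2"
proof -
  have "K * ((sn K d)\<^sup>2 - (proj K a d x)\<^sup>2) = K * ((sn K x)\<^sup>2 - (proj K a x d)\<^sup>2)"
    unfolding proj_swap[OF K a, of d x]
    using cs_eq_proj[OF K a, of d x] cs_sq_add[OF K, of a] cs_sq_add[OF K, of x]  cs_sq_add[OF K, of d] by algebra
  then show ?thesis using K by simp
qed

lemma proj_abs_le:
  assumes "K \<noteq> 0" "0 < a" "0 \<le> x" "0 \<le> d" "a \<le> x + d" "x \<le> a + d" "d \<le> a + x"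
    and "K > 0 \<Longrightarrow> a < pi / sqrt K \<and> x < pi / sqrt K \<and> a + x + d < 2 * pi / sqrt K"
  shows "\<bar>proj K a x d\<bar> \<le> sn K x"
proof (cases "x = 0")
  case True
  then show ?thesis using assms by (simp add: proj_def)
next
  case False
  then have x: "0 < sn K x" and a: "0 < sn K a" using assms by (auto intro!: sn_pos)
  let ?c = "(cs K d - cs K a * cs K x) / (K * (sn K a * sn K x))"
  have "\<bar>?c\<bar> \<le> 1" using assms False by (intro comp_angle_bound) auto
  then have "\<bar>sn K x * ?c\<bar> \<le> sn K x" unfolding abs_mult using x by (simp add: mult_left_le del: abs_divide)
  moreover have "proj K a x d = sn K x * ?c" using x by (simp add: proj_def mult.commute)
  ultimately show ?thesis by simp
qed

text \<open>Coordinates at A with first axis towards B: P is (u1, u2) and Q is (w1, -w2), on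
  opposite sides of AB, so \<open>cx * cf + K * (u1 * w1 - u2 * w2)\<close> is the inner product of
  P and Q. Seen from B, the component of Q towards A is \<open>v1\<close>, and
  \<open>u1 * v1 + u2 * w2\<close> is minus the product of BQ with the parallel translate of
  AP.\<close>

lemma model_lower:
  assumes K: "K \<noteq> 0" and a: "(ca::real)\<^sup>2 + K * sa\<^sup>2 = 1" "0 \<le> 1 + ca"
    and x: "cx\<^sup>2 + K * sx\<^sup>2 = 1" "sx\<^sup>2 = u1\<^sup>2 + u2\<^sup>2" "0 \<le> sx"
    and f: "cf\<^sup>2 + K * sf\<^sup>2 = 1" "sf\<^sup>2 = w1\<^sup>2 + w2\<^sup>2"
    and y: "cy\<^sup>2 + K * sy\<^sup>2 = 1" "0 \<le> sy"
    and d: "cd = cx * ca + K * (sa * u1)" and y': "cy = cf * ca + K * (sa * w1)"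
  shows "0 \<le> K * ((1 + ca) * (cx * cf + K * (u1 * w1 - u2 * w2) + cx * cy + K * (sx * sy)) - (cx + cd) * (cy + cf))"
proof -
  define v1 where "v1 = cf * sa - ca * w1"
  have "K * sy\<^sup>2 = K * (v1\<^sup>2 + w2\<^sup>2)"
    using a f y y' unfolding v1_def by algebra
  then have "sy\<^sup>2 = v1\<^sup>2 + w2\<^sup>2" using K by simp
  then have cs: "u1 * v1 + u2 * w2 \<le> sx * sy" using x y by (intro cauchy_schwarz_2) auto
  have "(1 + ca) * (cx * cf + K * (u1 * w1 - u2 * w2) + cx * cy + K * (sx * sy)) - (cx + cd) * (cy + cf)
    = K * ((1 + ca) * (sx * sy - (u1 * v1 + u2 * w2)))"
    using a d y' unfolding v1_def by algebra
  also have "K * \<dots> = K\<^sup>2 * ((1 + ca) * (sx * sy - (u1 * v1 + u2 * w2)))"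
    by (simp add: power2_eq_square)
  finally show ?thesis using cs a by (simp)
qed

text \<open>Coordinates at B with first axis towards P: A is (u1, u2) and Q is (w1, -w2). The
  parallel translate of AP to B is P - g A plus a multiple of B. Its components are
  \<open>T1\<close> and \<open>- T2\<close>, and the identity for \<open>sx\<close> says that
  translation preserves length.\<close>

lemma model_upper:
  assumes K: "K \<noteq> 0" and a: "(ca::real)\<^sup>2 + K * sa\<^sup>2 = 1" "sa\<^sup>2 = u1\<^sup>2 + u2\<^sup>2" "0 < 1 + ca"
    and d: "cd\<^sup>2 + K * sd\<^sup>2 = 1"
    and x: "cx\<^sup>2 + K * sx\<^sup>2 = 1" "0 \<le> sx"
    and y: "sy\<^sup>2 = w1\<^sup>2 + w2\<^sup>2" "0 \<le> sy"
    and x': "cx = ca * cd + K * (sd * u1)" and b: "cb = cy * cd + K * (sd * w1)"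
  shows "0 \<le> K * ((cx + cd) * (cy + (ca * cy + K * (u1 * w1 - u2 * w2))) - (1 + ca) * (cb + (cx * cy - K * (sx * sy))))"
proof -
  define g where "g = (cx + cd) / (1 + ca)"
  have g: "g * (1 + ca) = cx + cd" using a by (simp add: g_def)
  define T1 T2 where "T1 = sd - g * u1" and "T2 = g * u2"
  have *: "K * (T1\<^sup>2 + T2\<^sup>2) = K * sd\<^sup>2 - 2 * g * (K * (sd * u1)) + g * (g * (1 + ca)) * (1 - ca)"
    using a(1,2) unfolding T1_def T2_def by algebra
  have "K * sx\<^sup>2 = K * (T1\<^sup>2 + T2\<^sup>2)"
    unfolding * using g d x(1) x' by algebra
  then have "sx\<^sup>2 = T1\<^sup>2 + T2\<^sup>2" using K by simp
  then have cs: "T1 * w1 + T2 * w2 \<le> sx * sy" using x y by (intro cauchy_schwarz_2) auto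
  have "(cx + cd) * (cy + (ca * cy + K * (u1 * w1 - u2 * w2))) - (1 + ca) * (cb + (cx * cy - K * (sx * sy)))
    = K * ((1 + ca) * (sx * sy - (T1 * w1 + T2 * w2)))"
    using g b unfolding T1_def T2_def by algebra
  also have "K * \<dots> = K\<^sup>2 * ((1 + ca) * (sx * sy - (T1 * w1 + T2 * w2)))"
    by (simp add: power2_eq_square)
  finally show ?thesis using cs a by (simp)
qed

text \<open>Conditions \<open>A\<close> and \<open>B\<close> say that the angles of the model
  quadrilateral at the ends of the common side are less than pi, so the model segment PQ crosses
  that side. By \<open>via\<close> the real point at the crossing parameter is at least as close to
  both ends, and the triangle inequality through it bounds \<open>b\<close>.\<close>

lemma opposite_diagonal:
  assumes K: "K \<noteq> 0" and a: "0 < a" "K > 0 \<Longrightarrow> a < pi / sqrt K"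
    and b: "0 \<le> b"
    and sn: "0 \<le> sn K x" "0 \<le> sn K d" "0 \<le> sn K f" "0 \<le> sn K y"
    and cs: "K > 0 \<Longrightarrow> 0 \<le> cs K x \<and> 0 \<le> cs K d \<and> 0 \<le> cs K f \<and> 0 \<le> cs K y"
    and u1: "u\<^sub>1 = proj K a x d" and w1: "w\<^sub>1 = proj K a f y"
    and u2: "0 \<le> u\<^sub>2" "(sn K x)\<^sup>2 = u\<^sub>1\<^sup>2 + u\<^sub>2\<^sup>2" and w2: "0 \<le> w\<^sub>2" "(sn K f)\<^sup>2 = w\<^sub>1\<^sup>2 + w\<^sub>2\<^sup>2"
    and A: "0 < u\<^sub>1 * sn K f + w\<^sub>1 * sn K x"
    and B: "0 < proj K a d x * sn K y + proj K a y f * sn K d"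
    and via: "\<And>t. 0 \<le> t \<Longrightarrow> t \<le> a \<Longrightarrow> \<exists>p q. 0 \<le> p \<and> 0 \<le> q \<and> (K > 0 \<longrightarrow> p < pi / sqrt K \<and> q < pi / sqrt K) \<and>
      b \<le> p + q \<and> K * (sn K (a - t) * cs K x + sn K t * cs K d) \<le> K * (sn K a * cs K p) \<and>
      K * (sn K (a - t) * cs K f + sn K t * cs K y) \<le> K * (sn K a * cs K q)"
  shows "K * (cs K x * cs K f + K * (u\<^sub>1 * w\<^sub>1 - u\<^sub>2 * w\<^sub>2)) \<le> K * cs K b"
proof -
  define c where "c = cs K x * cs K f + K * (u\<^sub>1 * w\<^sub>1 - u\<^sub>2 * w\<^sub>2)"
  have sa: "0 < sn K a" using K a by (intro sn_pos) auto
  note ax = cs_sq_add[OF K, of x] and af = cs_sq_add[OF K, of f] and aa = cs_sq_add[OF K, of a]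
  have dx: "cs K d = cs K x * cs K a + K * (sn K a * u\<^sub>1)" unfolding u1 using K sa by (intro cs_eq_proj) auto
  have yf: "cs K y = cs K f * cs K a + K * (sn K a * w\<^sub>1)" unfolding w1 using K sa by (intro cs_eq_proj) auto
  define u\<^sub>1' w\<^sub>1' where "u\<^sub>1' = proj K a d x" and "w\<^sub>1' = proj K a y f"
  have u1': "u\<^sub>1' = sn K a * cs K x - cs K a * u\<^sub>1" and w1': "w\<^sub>1' = sn K a * cs K f - cs K a * w\<^sub>1"
    unfolding u\<^sub>1'_def w\<^sub>1'_def u1 w1 using K sa by (auto intro: proj_swap)
  have "(sn K d)\<^sup>2 = u\<^sub>1'\<^sup>2 + u\<^sub>2\<^sup>2" "(sn K y)\<^sup>2 = w\<^sub>1'\<^sup>2 + w\<^sub>2\<^sup>2"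
    using proj_height[of K a d x] proj_height[of K a y f] K sa u2 w2 unfolding u\<^sub>1'_def w\<^sub>1'_def u1 w1 by auto
  note u2' = this
  \<comment> \<open>The condition \<open>g * u\<^sub>2 = h * w\<^sub>2\<close> cancels the heights,
    so g P + h Q lies in the plane of A and B. The last two conditions make its coefficients there
    positive.\<close>
  obtain g h where gh: "0 \<le> g" "0 \<le> h" "g * u\<^sub>2 = h * w\<^sub>2"
    and m: "0 < g * u\<^sub>1 + h * w\<^sub>1" and l: "0 < g * u\<^sub>1' + h * w\<^sub>1'"
  proof (cases "0 < u\<^sub>2 + w\<^sub>2")
    case True
    then have "0 < u\<^sub>1 * w\<^sub>2 + w\<^sub>1 * u\<^sub>2" "0 < u\<^sub>1' * w\<^sub>2 + w\<^sub>1' * u\<^sub>2"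
      using cross_pos[OF sn(1,3) u2(1) w2(1) u2(2) w2(2) A] cross_pos[OF sn(2,4) u2(1) w2(1) u2'] B
      unfolding u\<^sub>1'_def w\<^sub>1'_def by auto
    then show ?thesis using u2 w2 by (intro that[of w\<^sub>2 u\<^sub>2]) (auto simp: mult.commute)
  next
    \<comment> \<open>Both triangles are flat, and P itself lies inside the common side.\<close>
    case False
    then have z: "u\<^sub>2 = 0" "w\<^sub>2 = 0" using u2 w2 by auto
    then have "sn K x = \<bar>u\<^sub>1\<bar>" "sn K f = \<bar>w\<^sub>1\<bar>" "sn K d = \<bar>u\<^sub>1'\<bar>" "sn K y = \<bar>w\<^sub>1'\<bar>"
      using sn u2 w2 u2' by (simp_all add: power2_eq_iff abs_if) (smt (verit))+
    then have "0 < u\<^sub>1" "0 < u\<^sub>1'"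
      using A B unfolding u\<^sub>1'_def[symmetric] w\<^sub>1'_def[symmetric]
      by (auto simp: abs_if mult_less_0_iff not_less zero_less_mult_iff split: if_splits)
    then show ?thesis using z by (intro that[of 1 0]) auto
  qed
  \<comment> \<open>These are the coefficients in g P + h Q = nu A + mu B. The equations
    \<open>P\<close> and \<open>Q\<close> below take inner products of this vector with P and
    Q.\<close>
  define \<mu> \<nu> where "\<mu> = (g * u\<^sub>1 + h * w\<^sub>1) / sn K a" and "\<nu> = (g * u\<^sub>1' + h * w\<^sub>1') / sn K a"
  have \<mu>: "\<mu> * sn K a = g * u\<^sub>1 + h * w\<^sub>1" and "\<nu> * sn K a = g * u\<^sub>1' + h * w\<^sub>1'"
    using sa by (auto simp: \<mu>_def \<nu>_def)
  then have "sn K a * (\<nu> + \<mu> * cs K a) = sn K a * (g * cs K x + h * cs K f)"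
    unfolding u1' w1' by algebra
  then have \<nu>: "\<nu> + \<mu> * cs K a = g * cs K x + h * cs K f" using sa by simp
  have "0 \<le> \<nu>" "0 \<le> \<mu>" "0 < \<nu> + \<mu>"
    using l m sa unfolding \<mu>_def \<nu>_def by (auto intro!: add_pos_pos)
  then obtain t k where t: "0 \<le> t" "t \<le> a" "0 < k" "\<nu> = k * sn K (a - t)" "\<mu> = k * sn K t"
    using cone_param[OF K a] by blast
  obtain p q where pq: "0 \<le> p" "0 \<le> q" "K > 0 \<longrightarrow> p < pi / sqrt K \<and> q < pi / sqrt K" "b \<le> p + q"
    and p: "K * (sn K (a - t) * cs K x + sn K t * cs K d) \<le> K * (sn K a * cs K p)"
    and q: "K * (sn K (a - t) * cs K f + sn K t * cs K y) \<le> K * (sn K a * cs K q)"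
    using via[OF t(1,2)] by blast
  have P: "g + h * c = \<nu> * cs K x + \<mu> * cs K d"
    unfolding c_def dx using ax u2(2) \<mu> \<nu> gh(3) by algebra
  have Q: "g * c + h = \<nu> * cs K f + \<mu> * cs K y"
    unfolding c_def yf using af w2(2) \<mu> \<nu> gh(3) by algebra
  have "k * (K * (sn K (a - t) * cs K x + sn K t * cs K d)) \<le> k * (K * (sn K a * cs K p))"
    using p t by simp
  then have p': "K * (g + h * c) \<le> K * (k * sn K a * cs K p)"
    unfolding P t by (simp add: algebra_simps)
  have "k * (K * (sn K (a - t) * cs K f + sn K t * cs K y)) \<le> k * (K * (sn K a * cs K q))"
    using q t by simp
  then have q': "K * (g * c + h) \<le> K * (k * sn K a * cs K q)"
    unfolding Q t by (simp add: algebra_simps)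
  have "K * c \<le> K * cs K b"
  proof (rule cs_dist_via_point[OF K gh(1,2) _ _ pq(1) _ p' pq(2) _ q' b pq(4)])
    show "0 < k * sn K a" using t sa by simp
    have "(k * sn K a)\<^sup>2 = \<nu>\<^sup>2 + \<mu>\<^sup>2 + 2 * \<nu> * \<mu> * cs K a"
      unfolding t sn_diff using cs_sq_add[OF K, of t] aa by algebra
    also have "\<dots> = (\<nu> + \<mu> * cs K a)\<^sup>2 + K * (\<mu> * sn K a)\<^sup>2"
      using aa by algebra
    also have "\<dots> = g\<^sup>2 + h\<^sup>2 + 2 * g * h * c"
      unfolding \<nu> \<mu> c_def using ax af u2(2) w2(2) gh(3) by algebra
    finally show "(k * sn K a)\<^sup>2 = g\<^sup>2 + h\<^sup>2 + 2 * g * h * c" .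
    show "0 \<le> g + h * c \<and> 0 \<le> g * c + h" if "K > 0"
      unfolding P Q using cs[OF that] \<open>0 \<le> \<nu>\<close> \<open>0 \<le> \<mu>\<close> by auto
    have "(u\<^sub>1 * w\<^sub>1 - u\<^sub>2 * w\<^sub>2)\<^sup>2 \<le> (sn K x * sn K f)\<^sup>2"
    proof -
      have "(sn K x * sn K f)\<^sup>2 - (u\<^sub>1 * w\<^sub>1 - u\<^sub>2 * w\<^sub>2)\<^sup>2 = (u\<^sub>1 * w\<^sub>2 + u\<^sub>2 * w\<^sub>1)\<^sup>2"
        unfolding power_mult_distrib u2 w2 by (simp add: power2_eq_square algebra_simps)
      then show ?thesis by (metis diff_ge_0_iff_ge zero_le_power2)
    qed
    then have UW: "\<bar>u\<^sub>1 * w\<^sub>1 - u\<^sub>2 * w\<^sub>2\<bar> \<le> sn K x * sn K f"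
      unfolding abs_le_square_iff[symmetric] using sn by simp
    \<comment> \<open>The value \<open>c\<close> belongs to a genuine distance because
      \<open>W\<close> lies between \<open>-S\<close> and \<open>S\<close>, the values for the flat
      positions x + f and x - f.\<close>
    define W S where "W = u\<^sub>1 * w\<^sub>1 - u\<^sub>2 * w\<^sub>2" and "S = sn K x * sn K f"
    have W: "W \<le> S" "- S \<le> W" using UW unfolding W_def S_def by auto
    have cW: "c = cs K x * cs K f + K * W" "cs K (x - f) = cs K x * cs K f + K * S"
      "cs K (x + f) = cs K x * cs K f + K * - S"
      unfolding c_def W_def S_def cs_diff[OF K] cs_add[OF K] by simp_all
    show "0 \<le> K * (1 - c\<^sup>2)"
    proof (cases "K > 0")
      case True
      have "K * W \<le> K * S" "K * - S \<le> K * W" using W True by (simp_all only: mult_le_cancel_left_pos)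
      then have "c \<le> cs K (x - f)" "cs K (x + f) \<le> c" unfolding cW by simp_all
      moreover have "\<bar>cs K s\<bar> \<le> 1" for s using True by (simp add: cs_def abs_le_iff)
      ultimately have "\<bar>c\<bar> \<le> 1" by (smt (verit))
      then show ?thesis using True by (simp add: abs_square_le_1)
    next
      case False
      then have K0: "K < 0" using K by simp
      have "1 \<le> cs K (x - f)" using K0 by (rule cs_ge_one)
      also have "K * S \<le> K * W" using W K0 by (simp only: mult_le_cancel_left_neg)
      then have "cs K (x - f) \<le> c" unfolding cW by simp
      finally have "1 \<le> c\<^sup>2" by simp
      then show ?thesis using K0 by (simp add: zero_le_mult_iff)
    qed
  qed (use pq in auto)
  then show ?thesis unfolding c_def .
qed

section \<open>The cosine of a quadrilateral\<close>

lemma sq_mult_left_mono: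
  fixes K :: real
  assumes "0 \<le> s" "u \<le> v" shows "K * (K * (s * u)) \<le> K * (K * (s * v))"
  using mult_left_mono[OF mult_left_mono[OF assms(2,1)], of "K * K"] by (simp only: mult.assoc zero_le_square)

text \<open>Condition \<open>A\<close> puts an angle of at least pi at A. Turn P about A, keeping
  \<open>x\<close>, onto the extension of QA: PQ becomes x + f, which is no shorter than
  \<open>b\<close>, and BP gets no longer. Both changes lower the expression, and the straightened
  figure is a case of \<open>model_lower\<close>.\<close>

lemma lower_at_vertex:
  assumes K: "K \<noteq> 0" and sn: "0 < sn K f" "0 \<le> sn K x" "0 \<le> sn K y" "0 < sn K a"
    and cs: "0 \<le> 1 + cs K a" "0 \<le> cs K y + cs K f"
    and w: "\<bar>proj K a f y\<bar> \<le> sn K f"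
    and A: "proj K a x d * sn K f + proj K a f y * sn K x \<le> 0"
    and b: "K * cs K (x + f) \<le> K * cs K b"
  shows "0 \<le> K * ((1 + cs K a) * (cs K b + cs K x * cs K y + K * (sn K x * sn K y)) -
    (cs K x + cs K d) * (cs K y + cs K f))"
proof -
  define w1 w2 where "w1 = proj K a f y" and "w2 = sqrt ((sn K f)\<^sup>2 - w1\<^sup>2)"
  have "w1\<^sup>2 \<le> (sn K f)\<^sup>2" unfolding w1_def abs_le_square_iff[symmetric] using w sn by simp
  then have w2: "(sn K f)\<^sup>2 = w1\<^sup>2 + w2\<^sup>2" unfolding w2_def by simp
  define r where "r = sn K x / sn K f"
  have r: "r * sn K f = sn K x" using sn by (simp add: r_def)
  have u1: "proj K a x d \<le> - r * w1"
    using A sn by (simp add: r_def w1_def field_simps)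
  have cd: "cs K d = cs K x * cs K a + K * (sn K a * proj K a x d)"
    and cy: "cs K y = cs K f * cs K a + K * (sn K a * w1)"
    unfolding w1_def using K sn by (auto intro!: cs_eq_proj)
  define cd' where "cd' = cs K x * cs K a + K * (sn K a * (- r * w1))"
  have "cs K x * cs K f + K * ((- r * w1) * w1 - (r * w2) * w2) = cs K (x + f)"
    unfolding cs_add[OF K] using w2 r by algebra
  moreover have "(sn K x)\<^sup>2 = (- r * w1)\<^sup>2 + (r * w2)\<^sup>2"
    using w2 r by algebra
  ultimately have m: "0 \<le> K * ((1 + cs K a) * (cs K (x + f) + cs K x * cs K y + K * (sn K x * sn K y)) -
    (cs K x + cd') * (cs K y + cs K f))"
    using model_lower[OF K cs_sq_add[OF K, of a] cs(1) cs_sq_add[OF K, of x] _ sn(2) cs_sq_add[OF K, of f] w2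
        cs_sq_add[OF K, of y] sn(3) cd'_def cy, of "r * w2"] by simp
  have "K * cs K d \<le> K * cd'"
  proof -
    have "K * (K * (sn K a * proj K a x d)) \<le> K * (K * (sn K a * (- r * w1)))"
      using u1 sn(4) by (intro sq_mult_left_mono) auto
    then show ?thesis unfolding cd cd'_def by (simp add: algebra_simps)
  qed
  then have "(K * cs K d) * (cs K y + cs K f) \<le> (K * cd') * (cs K y + cs K f)"
    by (rule mult_right_mono) (use cs in auto)
  moreover have "(1 + cs K a) * (K * cs K (x + f)) \<le> (1 + cs K a) * (K * cs K b)"
    by (rule mult_left_mono[OF b cs(1)])
  ultimately show ?thesis using m by (simp add: algebra_simps)
qed

text \<open>The angle at B is at least pi. Turning Q about B onto the extension of AB makes AQ equal
  to a + y and does not lengthen PQ; both changes lower the expression.\<close>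

lemma upper_at_vertex1:
  assumes K: "K \<noteq> 0" and sn: "0 \<le> sn K x" "0 \<le> sn K y" "0 < sn K a" "0 < sn K d"
    and cs: "0 < 1 + cs K a" "0 \<le> cs K x + cs K d"
    and u: "\<bar>proj K d a x\<bar> \<le> sn K a"
    and B: "proj K d a x * sn K y + proj K d y b * sn K a \<le> 0"
    and f: "K * cs K (a + y) \<le> K * cs K f"
  shows "0 \<le> K * ((cs K x + cs K d) * (cs K y + cs K f) -
    (1 + cs K a) * (cs K b + (cs K x * cs K y - K * (sn K x * sn K y))))"
proof -
  define u1 u2 where "u1 = proj K d a x" and "u2 = sqrt ((sn K a)\<^sup>2 - u1\<^sup>2)"
  have "u1\<^sup>2 \<le> (sn K a)\<^sup>2" unfolding u1_def abs_le_square_iff[symmetric] using u sn by simp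
  then have u2: "(sn K a)\<^sup>2 = u1\<^sup>2 + u2\<^sup>2" unfolding u2_def by simp
  define r where "r = sn K y / sn K a"
  have r: "r * sn K a = sn K y" using sn by (simp add: r_def)
  have w1: "proj K d y b \<le> - r * u1"
    using B sn by (simp add: r_def u1_def field_simps)
  have cx: "cs K x = cs K a * cs K d + K * (sn K d * u1)"
    and cb: "cs K b = cs K y * cs K d + K * (sn K d * proj K d y b)"
    unfolding u1_def using K sn by (auto intro!: cs_eq_proj)
  define cb' where "cb' = cs K y * cs K d + K * (sn K d * (- r * u1))"
  have "cs K a * cs K y + K * (u1 * (- r * u1) - u2 * (r * u2)) = cs K (a + y)"
    unfolding cs_add[OF K] using u2 r by algebra
  moreover have "(sn K y)\<^sup>2 = (- r * u1)\<^sup>2 + (r * u2)\<^sup>2"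
    using u2 r by algebra
  ultimately have m: "0 \<le> K * ((cs K x + cs K d) * (cs K y + cs K (a + y)) -
    (1 + cs K a) * (cb' + (cs K x * cs K y - K * (sn K x * sn K y))))"
    using model_upper[OF K cs_sq_add[OF K, of a] u2 cs(1) cs_sq_add[OF K, of d] cs_sq_add[OF K, of x] sn(1)
        _ sn(2) cx cb'_def, of "r * u2"] by simp
  have "K * cs K b \<le> K * cb'"
  proof -
    have "K * (K * (sn K d * proj K d y b)) \<le> K * (K * (sn K d * (- r * u1)))"
      using w1 sn(4) by (intro sq_mult_left_mono) auto
    then show ?thesis unfolding cb cb'_def by (simp add: algebra_simps)
  qed
  then have "(1 + cs K a) * (K * cs K b) \<le> (1 + cs K a) * (K * cb')"
    by (rule mult_left_mono) (use cs in auto)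
  moreover have "(cs K x + cs K d) * (K * cs K (a + y)) \<le> (cs K x + cs K d) * (K * cs K f)"
    by (rule mult_left_mono[OF f cs(2)])
  ultimately show ?thesis using m by (simp add: algebra_simps)
qed

text \<open>The angle at P is at least pi, and A is turned about P onto the extension of QP. Now the
  side AB changes, and it enters through 1 + \<open>cs K a\<close>, whose cofactor may be negative.
  Coordinates at P must also be carried over to B before \<open>model_upper\<close> applies.\<close>

lemma upper_at_vertex2:
  assumes K: "K \<noteq> 0" and sn: "0 \<le> sn K x" "0 \<le> sn K y" "0 < sn K b" "0 < sn K d"
    and cs: "0 \<le> cs K a" "0 \<le> cs K b" "0 \<le> cs K d" "0 \<le> cs K f" "0 \<le> cs K x" "0 \<le> cs K y"
    and s: "\<bar>proj K d b y\<bar> \<le> sn K b"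
    and P: "proj K d x a * sn K b + proj K d b y * sn K x \<le> 0"
    and f: "K * cs K (x + b) \<le> K * cs K f"
  shows "0 \<le> K * ((cs K x + cs K d) * (cs K y + cs K f) -
    (1 + cs K a) * (cs K b + (cs K x * cs K y - K * (sn K x * sn K y))))"
proof -
  let ?E = "cs K x * cs K y - K * (sn K x * sn K y)"
  define s1 s2 where "s1 = proj K d b y" and "s2 = sqrt ((sn K b)\<^sup>2 - s1\<^sup>2)"
  have "s1\<^sup>2 \<le> (sn K b)\<^sup>2" unfolding s1_def abs_le_square_iff[symmetric] using s sn by simp
  then have s2: "(sn K b)\<^sup>2 = s1\<^sup>2 + s2\<^sup>2" unfolding s2_def by simp
  define r where "r = sn K x / sn K b"
  have r: "r * sn K b = sn K x" "0 \<le> r" using sn by (auto simp: r_def)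
  have r1: "proj K d x a \<le> - r * s1"
    using P sn by (simp add: r_def s1_def field_simps)
  have ca: "cs K a = cs K x * cs K d + K * (sn K d * proj K d x a)"
    and cy: "cs K y = cs K b * cs K d + K * (sn K d * s1)"
    unfolding s1_def using K sn by (auto intro!: cs_eq_proj)
  define ca' where "ca' = cs K x * cs K d + K * (sn K d * (- r * s1))"
  have ca_le: "K * cs K a \<le> K * ca'"
  proof -
    have "K * (K * (sn K d * proj K d x a)) \<le> K * (K * (sn K d * (- r * s1)))"
      using r1 sn(4) by (intro sq_mult_left_mono) auto
    then show ?thesis unfolding ca ca'_def by (simp add: algebra_simps)
  qed
  \<comment> \<open>\<open>ca'\<close> replaces the cosine of a side that no pair of given points
    realises, so its sign has to be computed. For negative \<open>K\<close> it is at least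
    \<open>cs K (x - d)\<close>.\<close>
  have ca': "0 \<le> ca'"
  proof (cases "K > 0")
    case True
    then show ?thesis using ca_le cs by simp
  next
    case False
    then have K0: "K < 0" using K by simp
    have "0 \<le> cs K (x - d)" using cs_ge_one[OF K0, of "x - d"] by simp
    have "r * - s1 \<le> r * sn K b" using s r(2) by (intro mult_left_mono) (auto simp: s1_def)
    then have "sn K d * (- r * s1) \<le> sn K d * sn K x"
      unfolding r(1)[symmetric] by (intro mult_left_mono) (use sn(4) in auto)
    then have "K * (sn K d * sn K x) \<le> K * (sn K d * (- r * s1))"
      by (rule mult_left_mono_neg) (use K0 in auto)
    with \<open>0 \<le> cs K (x - d)\<close> show ?thesis
      unfolding ca'_def cs_diff[OF K] mult.commute[of "sn K x" "sn K d"] by linarith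
  qed
  define u1 u2 where "u1 = sn K d * cs K x - cs K d * (- r * s1)" and "u2 = r * s2"
  define w1 where "w1 = sn K d * cs K b - cs K d * s1"
  have sx: "(sn K x)\<^sup>2 = (- r * s1)\<^sup>2 + (r * s2)\<^sup>2" using s2 r by algebra
  have aa: "ca'\<^sup>2 + K * (sqrt (u1\<^sup>2 + u2\<^sup>2))\<^sup>2 = 1"
    unfolding ca'_def u1_def u2_def
    using cs_sq_add[OF K, of d] cs_sq_add[OF K, of x] sx by (simp add: algebra_simps) algebra
  have xx: "cs K x = ca' * cs K d + K * (sn K d * u1)"
    unfolding ca'_def u1_def using cs_sq_add[OF K, of d] by algebra
  have bb: "cs K b = cs K y * cs K d + K * (sn K d * w1)"
    unfolding w1_def cy using cs_sq_add[OF K, of d] by algebra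
  have "w1 = proj K d y b" unfolding w1_def s1_def using K sn by (auto intro: proj_swap[symmetric])
  then have "(sn K y)\<^sup>2 = w1\<^sup>2 + s2\<^sup>2"
    using proj_height[of K d y b] K sn s2 unfolding s1_def by auto
  moreover have "ca' * cs K y + K * (u1 * w1 - u2 * s2) = cs K (x + b)"
    unfolding cs_add[OF K] unfolding ca'_def u1_def u2_def w1_def cy
    using s2 r(1) cs_sq_add[OF K, of d] by algebra
  ultimately have m: "0 \<le> K * ((cs K x + cs K d) * (cs K y + cs K (x + b)) - (1 + ca') * (cs K b + ?E))"
    using model_upper[OF K aa _ _ cs_sq_add[OF K, of d] cs_sq_add[OF K, of x] sn(1) _ sn(2) xx bb, of u2 s2] ca' by simp
  have f': "(cs K x + cs K d) * (K * cs K (x + b)) \<le> (cs K x + cs K d) * (K * cs K f)"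
    by (rule mult_left_mono[OF f]) (use cs in auto)
  show ?thesis
  proof (cases "0 \<le> cs K b + ?E")
    case True
    then have "(K * cs K a) * (cs K b + ?E) \<le> (K * ca') * (cs K b + ?E)"
      using mult_right_mono[OF ca_le True] by simp
    then show ?thesis using m f' by (simp add: algebra_simps)
  next
    case False
    have "K > 0"
    proof (rule ccontr)
      assume "\<not> K > 0"
      then have "1 \<le> cs K (x + y)" using K by (intro cs_ge_one) simp
      then show False using False cs by (simp add: cs_add[OF K])
    qed
    moreover have "(1 + cs K a) * (cs K b + ?E) \<le> 0" using False cs by (intro mult_nonneg_nonpos) auto
    moreover have "0 \<le> (cs K x + cs K d) * (cs K y + cs K f)" using cs by simp
    ultimately show ?thesis by simp
  qed
qed

section \<open>The two inequalities for points of the domain\<close>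

context
  fixes K :: real
  assumes K: "K \<noteq> 0" and RK: "RK_domain K TYPE('a::metric_space)"
begin

lemma RK_sn_nonneg: "0 \<le> sn K (dist (X::'a) Y)"
  using K RK_dist_less[OF RK, of X Y] by (intro sn_nonneg) (auto simp: below_diam_def)

lemma RK_sn_pos: "X \<noteq> Y \<Longrightarrow> 0 < sn K (dist (X::'a) Y)"
  using K RK_dist_less[OF RK, of X Y] by (intro sn_pos) auto

lemma RK_proj_le:
  assumes "(X::'a) \<noteq> Y" shows "\<bar>proj K (dist X Y) (dist X Z) (dist Y Z)\<bar> \<le> sn K (dist X Z)"
  using assms K RK_dist_less[OF RK] RK_perimeter[OF RK, of X Y Z] dist_triangle[of X Y Z] dist_triangle[of X Z Y] dist_triangle[of Y Z X]
  by (intro proj_abs_le) (auto simp: dist_commute add.commute)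

lemma RK_four_point:
  fixes A B P Q :: 'a
  defines "u1 \<equiv> proj K (dist A B) (dist A P) (dist B P)" and "w1 \<equiv> proj K (dist A B) (dist A Q) (dist B Q)"
  assumes AB: "A \<noteq> B"
    and cs: "0 \<le> cs K (dist A P)" "0 \<le> cs K (dist B P)" "0 \<le> cs K (dist A Q)" "0 \<le> cs K (dist B Q)"
    and A: "0 < u1 * sn K (dist A Q) + w1 * sn K (dist A P)"
    and B: "0 < proj K (dist A B) (dist B P) (dist A P) * sn K (dist B Q) +
      proj K (dist A B) (dist B Q) (dist A Q) * sn K (dist B P)"
  obtains u2 w2 where "(sn K (dist A P))\<^sup>2 = u1\<^sup>2 + u2\<^sup>2" "(sn K (dist A Q))\<^sup>2 = w1\<^sup>2 + w2\<^sup>2"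
    "K * (cs K (dist A P) * cs K (dist A Q) + K * (u1 * w1 - u2 * w2)) \<le> K * cs K (dist P Q)"
proof -
  define u2 w2 where "u2 = sqrt ((sn K (dist A P))\<^sup>2 - u1\<^sup>2)" and "w2 = sqrt ((sn K (dist A Q))\<^sup>2 - w1\<^sup>2)"
  have "u1\<^sup>2 \<le> (sn K (dist A P))\<^sup>2" "w1\<^sup>2 \<le> (sn K (dist A Q))\<^sup>2"
    unfolding u1_def w1_def abs_le_square_iff[symmetric] using RK_proj_le[OF AB] RK_sn_nonneg by simp_all
  then have u2: "0 \<le> u2" "(sn K (dist A P))\<^sup>2 = u1\<^sup>2 + u2\<^sup>2" and w2: "0 \<le> w2" "(sn K (dist A Q))\<^sup>2 = w1\<^sup>2 + w2\<^sup>2"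
    unfolding u2_def w2_def by auto
  show ?thesis
  proof (rule that[OF u2(2) w2(2)], rule opposite_diagonal[of K "dist A B" "dist P Q" _ "dist B P" _ "dist B Q"])
    show "\<exists>p q. 0 \<le> p \<and> 0 \<le> q \<and> (K > 0 \<longrightarrow> p < pi / sqrt K \<and> q < pi / sqrt K) \<and> dist P Q \<le> p + q \<and>
      K * (sn K (dist A B - t) * cs K (dist A P) + sn K t * cs K (dist B P)) \<le> K * (sn K (dist A B) * cs K p) \<and>
      K * (sn K (dist A B - t) * cs K (dist A Q) + sn K t * cs K (dist B Q)) \<le> K * (sn K (dist A B) * cs K q)"
      if t: "0 \<le> t" "t \<le> dist A B" for t
    proof -
      obtain X where X: "\<And>P. K * (sn K (dist A B - t) * cs K (dist A P) + sn K t * cs K (dist B P)) \<le>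
          K * (sn K (dist A B) * cs K (dist X P))"
        using dist_to_side[OF K RK t] by blast
      show ?thesis
        using X[of P] X[of Q] RK_dist_less[OF RK] dist_triangle2[of P Q X]
        by (intro exI[of _ "dist X P"] exI[of _ "dist X Q"]) (auto simp: dist_commute)
    qed
  qed (use assms K u2 w2 RK_sn_nonneg RK_dist_less[OF RK] in auto)
qed

lemma RK_cs_mono:
  assumes "0 \<le> s" "s \<le> dist (X::'a) Y" shows "K * cs K (dist X Y) \<le> K * cs K s"
  using assms K RK_dist_less[OF RK, of X Y] by (intro cs_antimono) (auto simp: below_diam_def)

lemma RK_cs_mono_abs:
  assumes "\<bar>s\<bar> \<le> dist (X::'a) Y" shows "K * cs K (dist X Y) \<le> K * cs K s"
  using RK_cs_mono[of "\<bar>s\<bar>" X Y] assms by (simp add: abs_if split: if_splits)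

text \<open>Distances with nonnegative \<open>cs\<close> are at most a quarter circle, so their sum
  stays in the range where the triangle inequality can be read through \<open>cs\<close>.\<close>

lemma RK_cs_triangle:
  assumes "0 \<le> cs K (dist X Y)" "0 \<le> cs K (dist Y Z)"
  shows "K * cs K (dist (X::'a) Y + dist Y Z) \<le> K * cs K (dist X Z)"
proof (rule cs_antimono[OF K])
  show "below_diam K (dist X Y + dist Y Z)"
    unfolding below_diam_def
  proof
    assume "K > 0"
    then have "dist X Y \<le> pi / sqrt K / 2" "dist Y Z \<le> pi / sqrt K / 2"
      using below_diam_half[OF K _ zero_le_dist] assms RK_dist_less[OF RK] by blast+
    then show "dist X Y + dist Y Z \<le> pi / sqrt K" by simp
  qed
qed (auto intro: dist_triangle)

lemma RK_lower:
  fixes A B P Q :: 'a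
  assumes cs: "\<And>X Y. X \<in> {A, P, B, Q} \<Longrightarrow> Y \<in> {A, P, B, Q} \<Longrightarrow> 0 \<le> cs K (dist X Y)"
  shows "0 \<le> K * ((1 + cs K (dist A B)) * (cs K (dist P Q) + cs K (dist A P) * cs K (dist B Q) + K * (sn K (dist A P) * sn K (dist B Q))) -
    (cs K (dist A P) + cs K (dist B P)) * (cs K (dist B Q) + cs K (dist A Q)))"
proof -
  define a b x y d f where abx: "a = dist A B" "b = dist P Q" "x = dist A P" "y = dist B Q" "d = dist B P" "f = dist A Q"
  note sn = RK_sn_nonneg RK_sn_pos
  have cs0: "0 \<le> cs K a" "0 \<le> cs K b" "0 \<le> cs K x" "0 \<le> cs K y" "0 \<le> cs K d" "0 \<le> cs K f"
    unfolding abx using cs by auto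
  have "0 \<le> K * ((1 + cs K a) * (cs K b + cs K x * cs K y + K * (sn K x * sn K y)) -
    (cs K x + cs K d) * (cs K y + cs K f))"
  \<comment> \<open>These coincidences annihilate a side by which the general argument divides. Each
    reduces to one triangle inequality.\<close>
  proof (cases "A = B \<or> B = P \<or> A = Q")
    case True
    then consider "A = B" | "B = P" | "A = Q" by blast
    then show ?thesis
    proof cases
      case 1
      then have "a = 0" "d = x" "f = y" by (auto simp: abx)
      moreover have "K * cs K (x + y) \<le> K * cs K b"
        unfolding abx 1 using RK_cs_triangle[of P B Q] cs[of P B] cs[of B Q] by (simp add: dist_commute)
      ultimately show ?thesis using K by (simp add: cs_add algebra_simps)
    next
      case 2
      then have "d = 0" "x = a" "b = y" by (auto simp: abx)
      moreover have "K * cs K f \<le> K * cs K (a - y)"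
        unfolding abx using dist_triangle[of A B Q] dist_triangle[of B Q A] dist_triangle[of A Q B]
        by (intro RK_cs_mono_abs) (auto simp: dist_commute abs_le_iff)
      then have "0 \<le> (1 + cs K a) * (K * cs K (a - y) - K * cs K f)" using cs0 by simp
      ultimately show ?thesis using K by (simp add: cs_diff algebra_simps)
    next
      case 3
      then have "f = 0" "y = a" "b = x" by (auto simp: abx dist_commute)
      moreover have "K * cs K d \<le> K * cs K (a - x)"
        unfolding abx using dist_triangle[of A B P] dist_triangle[of B P A] dist_triangle[of A P B]
        by (intro RK_cs_mono_abs) (auto simp: dist_commute abs_le_iff)
      then have "0 \<le> (1 + cs K a) * (K * cs K (a - x) - K * cs K d)" using cs0 by simp
      ultimately show ?thesis using K by (simp add: cs_diff algebra_simps)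
    qed
  next
    case False
    then have AB: "A \<noteq> B" and pos: "0 < sn K a" "0 < sn K d" "0 < sn K f" unfolding abx using sn(2) by auto
    have nn: "0 \<le> sn K x" "0 \<le> sn K y" unfolding abx using sn(1) by auto
    have pw: "\<bar>proj K a f y\<bar> \<le> sn K f" "\<bar>proj K a d x\<bar> \<le> sn K d"
      using RK_proj_le[OF AB, of Q] RK_proj_le[OF AB[symmetric], of P] unfolding abx by (auto simp: dist_commute)
    consider "proj K a x d * sn K f + proj K a f y * sn K x \<le> 0"
      | "proj K a y f * sn K d + proj K a d x * sn K y \<le> 0"
      | "0 < proj K a x d * sn K f + proj K a f y * sn K x" "0 < proj K a d x * sn K y + proj K a y f * sn K d" by linarith
    then show ?thesis
    proof cases
      case 1
      show ?thesis
      proof (rule lower_at_vertex[OF K pos(3) nn pos(1) _ _ pw(1) 1])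
        show "K * cs K (x + f) \<le> K * cs K b"
          unfolding abx using RK_cs_triangle[of P A Q] cs[of P A] cs[of A Q] by (simp add: dist_commute)
      qed (use cs0 in auto)
    next
      case 2
      \<comment> \<open>The angle at B is treated like that at A, by exchanging (A, P) with (B,
        Q).\<close>
      have "0 \<le> K * ((1 + cs K a) * (cs K b + cs K y * cs K x + K * (sn K y * sn K x)) -
        (cs K y + cs K f) * (cs K x + cs K d))"
      proof (rule lower_at_vertex[OF K pos(2) nn(2,1) pos(1) _ _ pw(2) 2])
        show "K * cs K (y + d) \<le> K * cs K b"
          unfolding abx using RK_cs_triangle[of Q B P] cs[of Q B] cs[of B P] by (simp add: dist_commute)
      qed (use cs0 in auto)
      then show ?thesis by (simp add: mult.commute add.assoc)
    next
      case 3
      obtain u2 w2 where u2: "(sn K x)\<^sup>2 = (proj K a x d)\<^sup>2 + u2\<^sup>2" and w2: "(sn K f)\<^sup>2 = (proj K a f y)\<^sup>2 + w2\<^sup>2"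
        and le: "K * (cs K x * cs K f + K * (proj K a x d * proj K a f y - u2 * w2)) \<le> K * cs K b"
        using RK_four_point[OF AB, of P Q] 3 cs0 unfolding abx by metis
      have dd: "cs K d = cs K x * cs K a + K * (sn K a * proj K a x d)"
        and yy: "cs K y = cs K f * cs K a + K * (sn K a * proj K a f y)"
        using K pos by (auto intro!: cs_eq_proj)
      have "0 \<le> 1 + cs K a" using cs0 by simp
      note m = model_lower[OF K cs_sq_add[OF K, of a] this cs_sq_add[OF K, of x] u2 nn(1) cs_sq_add[OF K, of f] w2
        cs_sq_add[OF K, of y] nn(2) dd yy]
      have "(1 + cs K a) * (K * (cs K x * cs K f + K * (proj K a x d * proj K a f y - u2 * w2))) \<le> (1 + cs K a) * (K * cs K b)"
        by (rule mult_left_mono[OF le]) (use cs0 in auto)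
      then show ?thesis using m by (simp add: algebra_simps)
    qed
  qed
  then show ?thesis unfolding abx .
qed

lemma RK_upper:
  fixes A B P Q :: 'a
  assumes cs: "\<And>X Y. X \<in> {A, P, B, Q} \<Longrightarrow> Y \<in> {A, P, B, Q} \<Longrightarrow> 0 \<le> cs K (dist X Y)"
  shows "0 \<le> K * ((cs K (dist A P) + cs K (dist B P)) * (cs K (dist B Q) + cs K (dist A Q)) -
    (1 + cs K (dist A B)) * (cs K (dist P Q) + (cs K (dist A P) * cs K (dist B Q) - K * (sn K (dist A P) * sn K (dist B Q)))))"
proof -
  define a b x y d f where abx: "a = dist A B" "b = dist P Q" "x = dist A P" "y = dist B Q" "d = dist B P" "f = dist A Q"
  note sn = RK_sn_nonneg RK_sn_pos
  have cs0: "0 \<le> cs K a" "0 \<le> cs K b" "0 \<le> cs K x" "0 \<le> cs K y" "0 \<le> cs K d" "0 \<le> cs K f"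
    unfolding abx using cs by auto
  have nn: "0 \<le> sn K x" "0 \<le> sn K y" unfolding abx using sn(1) by auto
  have fa: "K * cs K (a + y) \<le> K * cs K f"
    unfolding abx using RK_cs_triangle[of A B Q] cs[of A B] cs[of B Q] by simp
  have fb: "K * cs K (x + b) \<le> K * cs K f"
    unfolding abx using RK_cs_triangle[of A P Q] cs[of A P] cs[of P Q] by simp
  have "0 \<le> K * ((cs K x + cs K d) * (cs K y + cs K f) -
    (1 + cs K a) * (cs K b + (cs K x * cs K y - K * (sn K x * sn K y))))"
  proof (cases "A = B \<or> B = P \<or> P = Q")
    case True
    then consider "A = B" | "B = P" | "P = Q" by blast
    then show ?thesis
    proof cases
      case 1
      then have "a = 0" "d = x" "f = y" by (auto simp: abx)
      moreover have "K * cs K b \<le> K * cs K (x - y)"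
        unfolding abx 1 using dist_triangle[of P B Q] dist_triangle[of B Q P] dist_triangle[of B P Q]
        by (intro RK_cs_mono_abs) (auto simp: dist_commute abs_le_iff)
      ultimately show ?thesis using K by (simp add: cs_diff algebra_simps)
    next
      case 2
      then have "d = 0" "x = a" "b = y" by (auto simp: abx)
      moreover have "0 \<le> (1 + cs K a) * (K * cs K f - K * cs K (a + y))" using fa cs0 by simp
      ultimately show ?thesis using K by (simp add: cs_add algebra_simps)
    next
      case 3
      then have "b = 0" "y = d" "f = x" by (auto simp: abx)
      moreover have "K * cs K a \<le> K * cs K (x - d)"
        unfolding abx using dist_triangle[of A B P] dist_triangle[of A P B] dist_triangle[of B P A]
        by (intro RK_cs_mono_abs) (auto simp: dist_commute abs_le_iff)
      moreover have "0 \<le> 1 + cs K (x + d)"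
      proof (cases "K > 0")
        case True
        then show ?thesis using cos_ge_minus_one[of "sqrt K * (x + d)"] by (simp only: cs_def if_True abs_of_pos)
      next
        case False
        then show ?thesis using cs_ge_one[of K "x + d"] K by simp
      qed
      \<comment> \<open>When P = Q the whole expression factors into this product, and the triangle
        inequality for A, B, P gives its sign.\<close>
      ultimately have "0 \<le> (1 + cs K (x + d)) * (K * cs K (x - d) - K * cs K a)" by simp
      also have "\<dots> = K * ((cs K x + cs K d) * (cs K d + cs K x) -
        (1 + cs K a) * (1 + (cs K x * cs K d - K * (sn K x * sn K d))))"
        unfolding cs_add[OF K] cs_diff[OF K] using cs_sq_add[OF K, of x] cs_sq_add[OF K, of d] by algebra
      finally show ?thesis using \<open>b = 0\<close> \<open>y = d\<close> \<open>f = x\<close> by simp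
    qed
  next
    case False
    then have BP: "B \<noteq> P" and pos: "0 < sn K a" "0 < sn K b" "0 < sn K d" unfolding abx using sn(2) by auto
    have pw: "\<bar>proj K d a x\<bar> \<le> sn K a" "\<bar>proj K d b y\<bar> \<le> sn K b"
      using RK_proj_le[OF BP, of A] RK_proj_le[OF BP[symmetric], of Q] unfolding abx by (auto simp: dist_commute)
    consider "proj K d a x * sn K y + proj K d y b * sn K a \<le> 0"
      | "proj K d x a * sn K b + proj K d b y * sn K x \<le> 0"
      | "0 < proj K d a x * sn K y + proj K d y b * sn K a" "0 < proj K d x a * sn K b + proj K d b y * sn K x" by linarith
    then show ?thesis
    proof cases
      case 1
      then show ?thesis using cs0 by (intro upper_at_vertex1[OF K nn pos(1,3) _ _ pw(1) 1 fa]) auto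
    next
      case 2
      then show ?thesis by (intro upper_at_vertex2[OF K nn pos(2,3) cs0(1,2,5,6,3,4) pw(2) 2 fb])
    next
      case 3
      obtain u2 w2 where u2: "(sn K a)\<^sup>2 = (proj K d a x)\<^sup>2 + u2\<^sup>2" and w2: "(sn K y)\<^sup>2 = (proj K d y b)\<^sup>2 + w2\<^sup>2"
        and le: "K * (cs K a * cs K y + K * (proj K d a x * proj K d y b - u2 * w2)) \<le> K * cs K f"
        using RK_four_point[OF BP, of A Q] 3 cs0 unfolding abx by (metis dist_commute)
      have xx: "cs K x = cs K a * cs K d + K * (sn K d * proj K d a x)"
        and bb: "cs K b = cs K y * cs K d + K * (sn K d * proj K d y b)"
        using K pos by (auto intro!: cs_eq_proj)
      have "0 < 1 + cs K a" using cs0 by simp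
      note m = model_upper[OF K cs_sq_add[OF K, of a] u2 this cs_sq_add[OF K, of d] cs_sq_add[OF K, of x] nn(1)
        w2 nn(2) xx bb]
      have "(cs K x + cs K d) * (K * (cs K a * cs K y + K * (proj K d a x * proj K d y b - u2 * w2))) \<le> (cs K x + cs K d) * (K * cs K f)"
        by (rule mult_left_mono[OF le]) (use cs0 in auto)
      then show ?thesis using m by (simp add: algebra_simps)
    qed
  qed
  then show ?thesis unfolding abx .
qed

end

text \<open>The factor \<open>K\<close> in the denominators absorbs the opposite signs of the two
  defining formulas.\<close>

lemma cosq_eq:
  assumes "K \<noteq> 0"
  shows "cosq K A P B Q = (cs K (dist P Q) + cs K (dist A P) * cs K (dist B Q)) / (K * (sn K (dist A P) * sn K (dist B Q)))
    - (cs K (dist A P) + cs K (dist B P)) * (cs K (dist B Q) + cs K (dist A Q))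
      / ((1 + cs K (dist A B)) * (K * (sn K (dist A P) * sn K (dist B Q))))"
proof -
  let ?s = "sqrt \<bar>K\<bar>"
  show ?thesis
  proof (cases "K > 0")
    case True
    then show ?thesis by (simp add: cosq_def Let_def cs_def sn_def dist_commute mult.assoc)
  next
    case False
    then have "K * (sn K x * sn K y) = - (sinh (?s * x) * sinh (?s * y))" for x y
      using assms by (simp add: sn_def)
    then show ?thesis using False
      by (simp add: cosq_def Let_def cs_def dist_commute mult.assoc flip: minus_divide_right minus_divide_left)
  qed
qed

theorem theorem4p1:
  fixes K :: real and A P B Q :: "'a::metric_space"
  assumes "K \<noteq> 0"
    and "RK_domain K TYPE('a)"
    and "A \<noteq> P" and "B \<noteq> Q"
    and "K > 0 \<Longrightarrow> \<forall>X\<in>{A, P, B, Q}. \<forall>Y\<in>{A, P, B, Q}. dist X Y \<le> pi / (2 * sqrt K)"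
  shows "\<bar>cosq K A P B Q\<bar> \<le> 1"
proof -
  have cs: "0 \<le> cs K (dist X Y)" if "X \<in> {A, P, B, Q}" "Y \<in> {A, P, B, Q}" for X Y
  proof (cases "K > 0")
    case True
    then have "dist X Y \<le> pi / (2 * sqrt K)" using assms(5) that by blast
    then have "sqrt K * dist X Y \<le> pi / 2" using True by (simp add: field_simps)
    moreover have "- (pi / 2) \<le> sqrt K * dist X Y" by (rule order_trans[of _ 0]) (use True in auto)
    ultimately show ?thesis using True by (simp add: cs_def cos_ge_zero)
  qed (simp add: cs_def)
  let ?c = "1 + cs K (dist A B)" and ?p = "sn K (dist A P) * sn K (dist B Q)"
  let ?N = "cs K (dist P Q) + cs K (dist A P) * cs K (dist B Q)"
  let ?M = "(cs K (dist A P) + cs K (dist B P)) * (cs K (dist B Q) + cs K (dist A Q))"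
  have pos: "0 < ?c" "0 < ?p"
    using cs[of A B] RK_sn_pos[OF assms(1,2)] assms(3,4) by (auto intro!: mult_pos_pos)
  define q where "q = cosq K A P B Q"
  have nz: "?c \<noteq> 0" "?p \<noteq> 0" using pos by (metis less_irrefl)+
  have "q = (?c * ?N - ?M) / (?c * (K * ?p))"
    using nz unfolding q_def cosq_eq[OF assms(1)] diff_divide_distrib by simp
  then have q: "?c * ?N - ?M = q * (?c * (K * ?p))"
    using nz assms(1) by (simp only: nonzero_eq_divide_eq mult_eq_0_iff de_Morgan_disj simp_thms)
  have "0 \<le> K * (?c * ?N - ?M + ?c * (K * ?p))"
    using RK_lower[OF assms(1,2), where A = A and P = P and B = B and Q = Q, OF cs] unfolding distrib_left[of ?c] by (simp only: diff_add_eq)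
  then have l: "0 \<le> (q + 1) * ((K * K) * (?c * ?p))" unfolding q by (simp add: algebra_simps)
 have "?M - ?c * (cs K (dist P Q) + (cs K (dist A P) * cs K (dist B Q) - K * ?p)) = - (?c * ?N - ?M) + ?c * (K * ?p)"
    by (simp add: algebra_simps)
  then have "0 \<le> K * (- (?c * ?N - ?M) + ?c * (K * ?p))"
    using RK_upper[OF assms(1,2), where A = A and P = P and B = B and Q = Q, OF cs] by metis
  then have u: "0 \<le> (1 - q) * ((K * K) * (?c * ?p))" unfolding q by (simp add: algebra_simps)
  \<comment> \<open>The two inequalities carry a factor \<open>K\<close> and \<open>cosq\<close>
    contributes another, so only the positive square remains.\<close>
  have "0 < (K * K) * (?c * ?p)"
    using pos assms(1) by (metis mult_pos_pos not_real_square_gt_zero)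
  then have "0 \<le> q + 1" "0 \<le> 1 - q"
    using l u mult_neg_pos[of "q + 1"] mult_neg_pos[of "1 - q"] by (meson not_le)+
  then show ?thesis unfolding q_def by simp
qed

end
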